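(* Let $\|\cdot\|$ be an admissible norm on $\mathbb{R}^3$ and let $f:M\to(\mathbb{R}^3,\|\cdot\|)$ be an immersed surface with negative Minkowski Gaussian curvature. Then $M$ is a minimal surface if and only if its Birkhoff-Gauss map $\eta$ is conformal with respect to the weighted Dupin metric. Likewise, $M$ is a minimal surface if and only if $\eta$ is conformal with respect to the Dupin metric.
   Context: A norm $\|\cdot\|$ on $\mathbb{R}^3$ is admissible if its unit sphere $\partial B=\{x\in\mathbb{R}^3:\|x\|=1\}$ is a smooth surface of strictly positive Gaussian curvature in the usual Euclidean geometry of $\mathbb{R}^3$. A non-zero vector $v$ is Birkhoff orthogonal to a plane $P$ (through the origin), written $v\dashv_B P$, if $\|v+tw\|\ge\|v\|$ for all $t\in\mathbb{R}$, $w\in P$. Surfaces are smooth and orientable, immersions are smooth, and $M$ is identified with its image, $T_pM$ being regarded as a plane in $\mathbb{R}^3$. The Birkhoff-Gauss map $\eta:M\to\partial B$ is a globally defined smooth map with $\eta(p)\dashv_B T_pM$ for all $p$ (one of the two choices is fixed). Since $T_{\eta(p)}\partial B$ is parallel to $T_pM$, $d\eta_p$ is an endomorphism of $T_pM$. The Minkowski Gaussian curvature is $K(p)=\det(d\eta_p)$ and the Minkowski mean curvature is $H(p)=\frac12\mathrm{tr}(d\eta_p)$. $M$ is minimal if $H$ vanishes everywhere. Let $\langle\cdot,\cdot\rangle$ be the usual inner product, let $u^{-1}:\partial B\to\partial B_e$ be the (outward) Euclidean Gauss map of $\partial B$, where $\partial B_e$ is the Euclidean unit sphere, and let $\xi$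 be the Euclidean Gauss map of $M$, oriented so that $\eta=u\circ\xi$. The Dupin metric on $M$ is the Riemannian metric $(X,Y)\mapsto\langle du^{-1}_{\eta(p)}X,Y\rangle$, and the weighted Dupin metric is $$b(X,Y)=\frac{\langle du^{-1}_{\eta(p)}X,Y\rangle}{\langle\eta(p),\xi(p)\rangle},\qquad X,Y\in T_pM.$$ The map $\eta$ is conformal with respect to a Riemannian metric $m$ of this kind if there is a positive function $\lambda:M\to\mathbb{R}$ with $m_p(d\eta_pX,d\eta_pY)=\lambda(p)\,m_p(X,Y)$ for all $p\in M$, $X,Y\in T_pM$ ($d\eta_p$ being viewed as an endomorphism of $T_pM$). *)

theory Defs
  imports "HOL-Analysis.Analysis"
begin

section \<open>Smooth maps on open subsets of normed spaces\<close>

text \<open>Only meaningful for open \<open>S\<close>, since the derivatives are taken at interior points.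
  Continuity of all iterated directional derivatives of a differentiable map amounts to
  \<open>C\<close>-infinity in finite dimension.\<close>

primrec times_differentiable_on ::
  "nat \<Rightarrow> 'a::real_normed_vector set \<Rightarrow> ('a \<Rightarrow> 'b::real_normed_vector) \<Rightarrow> bool" where
  "times_differentiable_on 0 S f \<longleftrightarrow> continuous_on S f"
| "times_differentiable_on (Suc n) S f \<longleftrightarrow>
     (\<forall>x\<in>S. f differentiable (at x)) \<and>
     (\<forall>v. times_differentiable_on n S (\<lambda>x. frechet_derivative f (at x) v))"

definition smooth_on :: "'a::real_normed_vector set \<Rightarrow> ('a \<Rightarrow> 'b::real_normed_vector) \<Rightarrow> bool" where
  "smooth_on S f \<longleftrightarrow> (\<forall>n. times_differentiable_on n S f)"

section \<open>Trace and determinant of an endomorphism of a linear subspace\<close>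

text \<open>\<open>L\<close> is only relevant on \<open>P\<close>, which it should map into itself. The entry of its matrix in
  row \<open>b\<close> and column \<open>c\<close> is \<open>representation B (L c) b\<close>; trace and determinant do not depend
  on the choice of the basis.\<close>

definition some_basis :: "'a::euclidean_space set \<Rightarrow> 'a set" where
  "some_basis P = (SOME B. independent B \<and> span B = P)"

definition trace_on :: "'a::euclidean_space set \<Rightarrow> ('a \<Rightarrow> 'a) \<Rightarrow> real" where
  "trace_on P L = (let B = some_basis P in \<Sum>b\<in>B. representation B (L b) b)"

definition det_on :: "'a::euclidean_space set \<Rightarrow> ('a \<Rightarrow> 'a) \<Rightarrow> real" where
  "det_on P L = (let B = some_basis P in
     \<Sum>\<sigma> | \<sigma> permutes B. of_int (sign \<sigma>) * (\<Prod>b\<in>B. representation B (L (\<sigma> b)) b))"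

section \<open>Abstract smooth surfaces\<close>

type_synonym 'm chart = "'m set \<times> ('m \<Rightarrow> real^2)"

definition is_chart :: "'m topology \<Rightarrow> 'm chart \<Rightarrow> bool" where
  "is_chart M = (\<lambda>(U, \<phi>). openin M U \<and> open (\<phi> ` U) \<and>
     homeomorphic_map (subtopology M U) (top_of_set (\<phi> ` U)) \<phi>)"

definition transition :: "'m chart \<Rightarrow> 'm chart \<Rightarrow> real^2 \<Rightarrow> real^2" where
  "transition = (\<lambda>(U, \<phi>) (V, \<psi>). \<psi> \<circ> inv_into U \<phi>)"

definition smooth_atlas :: "'m topology \<Rightarrow> 'm chart set \<Rightarrow> bool" where
  "smooth_atlas M A \<longleftrightarrow>
     (\<forall>c\<in>A. is_chart M c) \<and>
     topspace M = (\<Union>c\<in>A. fst c) \<and>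
     (\<forall>c\<in>A. \<forall>d\<in>A. smooth_on (snd c ` (fst c \<inter> fst d)) (transition c d))"

definition oriented_atlas :: "'m chart set \<Rightarrow> bool" where
  "oriented_atlas A \<longleftrightarrow>
     (\<forall>c\<in>A. \<forall>d\<in>A. \<forall>x \<in> snd c ` (fst c \<inter> fst d).
        0 < det (matrix (frechet_derivative (transition c d) (at x))))"

text \<open>Surfaces are not required to be connected; the last conjunct is orientability.\<close>

definition smooth_surface :: "'m topology \<Rightarrow> 'm chart set \<Rightarrow> bool" where
  "smooth_surface M A \<longleftrightarrow>
     Hausdorff_space M \<and> second_countable M \<and> smooth_atlas M A \<and>
     (\<exists>A'. smooth_atlas M A' \<and> smooth_atlas M (A \<union> A') \<and> oriented_atlas A')"

section \<open>Maps from a surface into Euclidean space\<close>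

definition in_chart :: "('m \<Rightarrow> 'b) \<Rightarrow> 'm chart \<Rightarrow> real^2 \<Rightarrow> 'b" where
  "in_chart g = (\<lambda>(U, \<phi>). g \<circ> inv_into U \<phi>)"

definition smooth_map :: "'m chart set \<Rightarrow> ('m \<Rightarrow> 'b::real_normed_vector) \<Rightarrow> bool" where
  "smooth_map A g \<longleftrightarrow> (\<forall>c\<in>A. smooth_on (snd c ` fst c) (in_chart g c))"

definition chart_at :: "'m chart set \<Rightarrow> 'm \<Rightarrow> 'm chart" where
  "chart_at A p = (SOME c. c \<in> A \<and> p \<in> fst c)"

text \<open>The differential of \<open>g\<close> at \<open>p\<close>, the tangent space being identified with \<open>\<real>\<^sup>2\<close> through the
  selected chart around \<open>p\<close>. The notions derived from it below do not depend on that chart.\<close>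

definition differential :: "'m chart set \<Rightarrow> ('m \<Rightarrow> 'b::real_normed_vector) \<Rightarrow> 'm \<Rightarrow> real^2 \<Rightarrow> 'b" where
  "differential A g p =
     frechet_derivative (in_chart g (chart_at A p)) (at (snd (chart_at A p) p))"

definition immersion :: "'m topology \<Rightarrow> 'm chart set \<Rightarrow> ('m \<Rightarrow> real^3) \<Rightarrow> bool" where
  "immersion M A f \<longleftrightarrow> smooth_map A f \<and> (\<forall>p\<in>topspace M. inj (differential A f p))"

definition tangent_plane :: "'m chart set \<Rightarrow> ('m \<Rightarrow> real^3) \<Rightarrow> 'm \<Rightarrow> (real^3) set" where
  "tangent_plane A f p = range (differential A f p)"

text \<open>The differential \<open>dg\<^sub>p\<close> of a map \<open>g\<close> on \<open>M\<close>, regarded as a map on the plane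
  \<open>T\<^sub>pM = tangent_plane A f p\<close> in \<open>\<real>\<^sup>3\<close>: it sends \<open>df\<^sub>p v\<close> to \<open>dg\<^sub>p v\<close>.\<close>

definition tangent_map ::
  "'m chart set \<Rightarrow> ('m \<Rightarrow> real^3) \<Rightarrow> ('m \<Rightarrow> real^3) \<Rightarrow> 'm \<Rightarrow> real^3 \<Rightarrow> real^3" where
  "tangent_map A f g p X = differential A g p (inv (differential A f p) X)"

definition euclidean_gauss_map ::
  "'m topology \<Rightarrow> 'm chart set \<Rightarrow> ('m \<Rightarrow> real^3) \<Rightarrow> ('m \<Rightarrow> real^3) \<Rightarrow> bool" where
  "euclidean_gauss_map M A f \<xi> \<longleftrightarrow> smooth_map A \<xi> \<and>
     (\<forall>p\<in>topspace M. norm (\<xi> p) = 1 \<and> (\<forall>X\<in>tangent_plane A f p. \<xi> p \<bullet> X = 0))"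

section \<open>Admissible norms\<close>

definition is_norm :: "('a::real_vector \<Rightarrow> real) \<Rightarrow> bool" where
  "is_norm N \<longleftrightarrow> (\<forall>x. N x = 0 \<longleftrightarrow> x = 0) \<and> (\<forall>c x. N (c *\<^sub>R x) = \<bar>c\<bar> * N x) \<and>
     (\<forall>x y. N (x + y) \<le> N x + N y)"

definition unit_sphere :: "('a \<Rightarrow> real) \<Rightarrow> 'a set" where
  "unit_sphere N = {x. N x = 1}"

text \<open>The inverses of the regular parametrizations of \<open>S \<subseteq> \<real>\<^sup>3\<close>: homeomorphisms from relatively
  open subsets of \<open>S\<close> onto open sets of parameters whose inverse is a smooth immersion into
  \<open>\<real>\<^sup>3\<close>. The set \<open>S\<close> is a smooth (embedded) surface if their domains cover it.\<close>

definition embedded_charts :: "(real^3) set \<Rightarrow> (real^3) chart set" where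
  "embedded_charts S = {(U, \<phi>). is_chart (top_of_set S) (U, \<phi>) \<and>
     smooth_on (\<phi> ` U) (inv_into U \<phi>) \<and>
     (\<forall>x\<in>\<phi> ` U. inj (frechet_derivative (inv_into U \<phi>) (at x)))}"

definition embedded_surface :: "(real^3) set \<Rightarrow> bool" where
  "embedded_surface S \<longleftrightarrow> S = (\<Union>c\<in>embedded_charts S. fst c)"

definition sphere_tangent :: "(real^3 \<Rightarrow> real) \<Rightarrow> real^3 \<Rightarrow> (real^3) set" where
  "sphere_tangent N q = tangent_plane (embedded_charts (unit_sphere N)) (\<lambda>x. x) q"

text \<open>The map \<open>u\<^sup>-\<^sup>1\<close>: the Euclidean unit normal of the unit sphere of \<open>N\<close> that points out of the
  unit ball of \<open>N\<close>, and its differential as a map on the tangent plane at \<open>q\<close>.\<close>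

definition u_inv :: "(real^3 \<Rightarrow> real) \<Rightarrow> real^3 \<Rightarrow> real^3" where
  "u_inv N q = (THE n. norm n = 1 \<and> (\<forall>X\<in>sphere_tangent N q. n \<bullet> X = 0) \<and>
     (\<forall>\<^sub>F t in at_right 0. N (q + t *\<^sub>R n) > 1))"

definition d_u_inv :: "(real^3 \<Rightarrow> real) \<Rightarrow> real^3 \<Rightarrow> real^3 \<Rightarrow> real^3" where
  "d_u_inv N q = tangent_map (embedded_charts (unit_sphere N)) (\<lambda>x. x) (u_inv N) q"

text \<open>\<open>det (du\<^sup>-\<^sup>1\<^sub>q)\<close> is the Euclidean Gaussian curvature of the unit sphere at \<open>q\<close>.\<close>

definition admissible :: "(real^3 \<Rightarrow> real) \<Rightarrow> bool" where
  "admissible N \<longleftrightarrow> is_norm N \<and> embedded_surface (unit_sphere N) \<and>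
     (\<forall>q\<in>unit_sphere N. 0 < det_on (sphere_tangent N q) (d_u_inv N q))"

section \<open>Minkowski geometry of immersed surfaces\<close>

definition birkhoff_orthogonal :: "('a::real_vector \<Rightarrow> real) \<Rightarrow> 'a \<Rightarrow> 'a set \<Rightarrow> bool" where
  "birkhoff_orthogonal N v P \<longleftrightarrow> v \<noteq> 0 \<and> (\<forall>t. \<forall>w\<in>P. N (v + t *\<^sub>R w) \<ge> N v)"

definition birkhoff_gauss_map ::
  "(real^3 \<Rightarrow> real) \<Rightarrow> 'm topology \<Rightarrow> 'm chart set \<Rightarrow> ('m \<Rightarrow> real^3) \<Rightarrow> ('m \<Rightarrow> real^3) \<Rightarrow> bool" where
  "birkhoff_gauss_map N M A f \<eta> \<longleftrightarrow> smooth_map A \<eta> \<and>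
     (\<forall>p\<in>topspace M. \<eta> p \<in> unit_sphere N \<and> birkhoff_orthogonal N (\<eta> p) (tangent_plane A f p))"

definition minkowski_gauss_curvature ::
  "'m chart set \<Rightarrow> ('m \<Rightarrow> real^3) \<Rightarrow> ('m \<Rightarrow> real^3) \<Rightarrow> 'm \<Rightarrow> real" where
  "minkowski_gauss_curvature A f \<eta> p = det_on (tangent_plane A f p) (tangent_map A f \<eta> p)"

definition minkowski_mean_curvature ::
  "'m chart set \<Rightarrow> ('m \<Rightarrow> real^3) \<Rightarrow> ('m \<Rightarrow> real^3) \<Rightarrow> 'm \<Rightarrow> real" where
  "minkowski_mean_curvature A f \<eta> p = trace_on (tangent_plane A f p) (tangent_map A f \<eta> p) / 2"

definition minimal ::
  "'m topology \<Rightarrow> 'm chart set \<Rightarrow> ('m \<Rightarrow> real^3) \<Rightarrow> ('m \<Rightarrow> real^3) \<Rightarrow> bool" where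
  "minimal M A f \<eta> \<longleftrightarrow> (\<forall>p\<in>topspace M. minkowski_mean_curvature A f \<eta> p = 0)"

text \<open>The metrics are meant for \<open>X, Y \<in> T\<^sub>pM\<close>, which is the tangent plane of the unit sphere at
  \<open>\<eta> p\<close>.\<close>

definition dupin_metric ::
  "(real^3 \<Rightarrow> real) \<Rightarrow> ('m \<Rightarrow> real^3) \<Rightarrow> 'm \<Rightarrow> real^3 \<Rightarrow> real^3 \<Rightarrow> real" where
  "dupin_metric N \<eta> p X Y = d_u_inv N (\<eta> p) X \<bullet> Y"

definition weighted_dupin_metric ::
  "(real^3 \<Rightarrow> real) \<Rightarrow> ('m \<Rightarrow> real^3) \<Rightarrow> ('m \<Rightarrow> real^3) \<Rightarrow> 'm \<Rightarrow> real^3 \<Rightarrow> real^3 \<Rightarrow> real" where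
  "weighted_dupin_metric N \<eta> \<xi> p X Y = (d_u_inv N (\<eta> p) X \<bullet> Y) / (\<eta> p \<bullet> \<xi> p)"

definition conformal ::
  "'m topology \<Rightarrow> 'm chart set \<Rightarrow> ('m \<Rightarrow> real^3) \<Rightarrow> ('m \<Rightarrow> real^3) \<Rightarrow>
   ('m \<Rightarrow> real^3 \<Rightarrow> real^3 \<Rightarrow> real) \<Rightarrow> bool" where
  "conformal M A f \<eta> m \<longleftrightarrow> (\<exists>\<rho>. (\<forall>p\<in>topspace M. 0 < \<rho> p) \<and>
     (\<forall>p\<in>topspace M. \<forall>X\<in>tangent_plane A f p. \<forall>Y\<in>tangent_plane A f p.
        m p (tangent_map A f \<eta> p X) (tangent_map A f \<eta> p Y) = \<rho> p * m p X Y))"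

end

theory Submission
  imports Defs
begin

text \<open>
  Write \<open>P\<close> for the tangent plane of \<open>M\<close> at \<open>p\<close>, \<open>L\<close> for \<open>d\<eta>\<^sub>p\<close> and \<open>D\<close> for the differential of
  \<open>u\<^sup>-\<^sup>1\<close> at \<open>\<eta> p\<close>; both are endomorphisms of \<open>P\<close>. The form \<open>b (X, Y) = \<langle>D X, Y\<rangle>\<close> is symmetric,
  because \<open>D\<close> is the Euclidean shape operator of the unit sphere, and it is nondegenerate, because
  \<open>det D\<close> is the Gaussian curvature of that sphere. By the chain rule \<open>D \<circ> L\<close> is the differential
  of the Euclidean Gauss map \<open>\<xi> = u\<^sup>-\<^sup>1 \<circ> \<eta>\<close>, which is again symmetric; so \<open>L\<close> is self-adjoint for
  \<open>b\<close> and \<open>b (L X, L Y) = b (X, L (L Y))\<close>. Hence \<open>\<eta>\<close> is conformal at \<open>p\<close> with factor \<open>r\<close> exactly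
  if \<open>L \<circ> L = r\<close>. The Cayley--Hamilton identity \<open>L \<circ> L = tr L \<cdot> L - det L\<close> settles the rest:
  if \<open>tr L = 0\<close>, then \<open>r = - det L\<close>, which is positive; conversely, if \<open>L \<circ> L = r\<close> and
  \<open>tr L \<noteq> 0\<close>, then \<open>L\<close> is a multiple of the identity and \<open>det L\<close> is a square, contrary to
  \<open>K < 0\<close>. This is \<open>trace_zero_iff_conformal\<close>. The weight in the second metric is a nonzero
  constant at each point and cancels.

  The analytic work is to see that the data have these properties. A unit vector \<open>n\<close> normal to a
  supporting plane of the unit ball at \<open>q\<close> determines the tangent plane of the sphere at \<open>q\<close> in
  every chart, since \<open>\<langle>n, -\<rangle>\<close> restricted to the sphere is maximal at \<open>q\<close>
  (\<open>embedded_chart_range\<close>); this gives \<open>u_inv N q = n\<close> (\<open>u_inv_eq\<close>), its differentiability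
  (\<open>u_inv_differentiable\<close>), and also that \<open>L\<close> maps \<open>P\<close> to itself, because Birkhoff orthogonality
  says that \<open>\<eta> p + P\<close> is a supporting plane. Symmetry of \<open>D\<close> and of \<open>D \<circ> L\<close> comes from the
  symmetry of second derivatives (\<open>normal_derivative_symmetric\<close>). The chain rule
  \<open>d_u_inv_chain_rule\<close> is stated for maps into the sphere that are differentiable as maps into
  space; it uses that such a map remains differentiable when read in a chart of the sphere
  (\<open>has_derivative_factor_immersion\<close>).
\<close>

section \<open>Endomorphisms of a plane\<close>

lemma permutations_doubleton:
  assumes "a \<noteq> b"
  shows "{\<sigma>. \<sigma> permutes {a, b}} = {id, Transposition.transpose a b}"
proof (rule card_subset_eq[symmetric])
  show "finite {\<sigma>. \<sigma> permutes {a, b}}"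
    by (rule finite_permutations) simp
  show "{id, Transposition.transpose a b} \<subseteq> {\<sigma>. \<sigma> permutes {a, b}}"
    by (auto intro: permutes_id permutes_swap_id)
  have "Transposition.transpose a b \<noteq> id"
    using assms by (metis id_apply transpose_apply_first)
  then show "card {id, Transposition.transpose a b} = card {\<sigma>. \<sigma> permutes {a, b}}"
    using card_permutations[of "{a, b}" 2] assms by (simp add: fact_2)
qed

lemma plane_endomorphism_matrix:
  fixes P :: "'a::euclidean_space set"
  assumes P: "subspace P" "dim P = 2" and LP: "\<And>X. X \<in> P \<Longrightarrow> L X \<in> P"
  obtains e g a b c d where "e \<noteq> g" "independent {e, g}" "span {e, g} = P"
    "L e = a *\<^sub>R e + c *\<^sub>R g" "L g = b *\<^sub>R e + d *\<^sub>R g"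
    "trace_on P L = a + d" "det_on P L = a * d - b * c"
proof -
  define B where "B = some_basis P"
  have "\<exists>B. independent B \<and> span B = P"
    using basis_exists[of P] P(1) by (metis span_subspace)
  then have B: "independent B" "span B = P"
    unfolding B_def some_basis_def by (metis (mono_tags, lifting) someI_ex)+
  have "card B = 2"
    using B P(2) by (metis dim_span_eq_card_independent)
  then obtain e g where eg: "B = {e, g}" "e \<noteq> g"
    by (meson card_2_iff)
  have rep: "v = representation B v e *\<^sub>R e + representation B v g *\<^sub>R g" if "v \<in> P" for v
    using real_vector.sum_representation_eq[OF B(1), of v B] that B(2) eg by simp
  have P': "e \<in> P" "g \<in> P"
    using B(2) eg by (auto intro: span_base)
  have "sign (Transposition.transpose e g) = -1"
    using eg(2) by (simp add: sign_swap_id)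
  moreover have "id \<noteq> Transposition.transpose e g"
    using eg(2) by (metis id_apply transpose_apply_first)
  ultimately have "det_on P L = representation B (L e) e * representation B (L g) g
      - representation B (L g) e * representation B (L e) g"
    unfolding det_on_def B_def[symmetric] Let_def eg(1) permutations_doubleton[OF eg(2)]
    using eg(2) by simp
  moreover have "trace_on P L = representation B (L e) e + representation B (L g) g"
    unfolding trace_on_def B_def[symmetric] Let_def using eg by simp
  ultimately show ?thesis
    using that[of e g] B eg rep LP P' by blast
qed

text \<open>Written out in the basis that defines trace and determinant. Linearity is only required on the
  plane, because the differential of a map on a surface is only meaningful on the tangent plane.\<close>

lemma cayley_hamilton_plane:
  fixes P :: "'a::euclidean_space set"
  assumes P: "subspace P" "dim P = 2" and LP: "\<And>X. X \<in> P \<Longrightarrow> L X \<in> P"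
    and lin: "\<And>X Y s t. X \<in> P \<Longrightarrow> Y \<in> P \<Longrightarrow> L (s *\<^sub>R X + t *\<^sub>R Y) = s *\<^sub>R L X + t *\<^sub>R L Y"
    and X: "X \<in> P"
  shows "L (L X) = trace_on P L *\<^sub>R L X - det_on P L *\<^sub>R X"
proof -
  obtain e g a b c d where *: "e \<noteq> g" "independent {e, g}" "span {e, g} = P"
    "L e = a *\<^sub>R e + c *\<^sub>R g" "L g = b *\<^sub>R e + d *\<^sub>R g"
    "trace_on P L = a + d" "det_on P L = a * d - b * c"
    by (rule plane_endomorphism_matrix[OF P LP])
  have P': "e \<in> P" "g \<in> P"
    using *(3) by (auto intro: span_base)
  obtain s where "X - s *\<^sub>R e \<in> span {g}"
    using X *(3) span_breakdown_eq by blast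
  then obtain t where "X - s *\<^sub>R e = t *\<^sub>R g"
    by (auto simp: span_singleton)
  then have X': "X = s *\<^sub>R e + t *\<^sub>R g"
    by (simp add: algebra_simps)
  have lin': "L (s *\<^sub>R e + t *\<^sub>R g) = s *\<^sub>R (a *\<^sub>R e + c *\<^sub>R g) + t *\<^sub>R (b *\<^sub>R e + d *\<^sub>R g)" for s t
    using lin[OF P'] *(4,5) by metis
  have LX: "L X = (s * a + t * b) *\<^sub>R e + (s * c + t * d) *\<^sub>R g"
    unfolding X' lin' by (simp add: algebra_simps)
  show ?thesis
    unfolding LX lin' unfolding X' *(6,7) by (simp add: algebra_simps)
qed

lemma det_on_scaling:
  fixes P :: "'a::euclidean_space set"
  assumes P: "subspace P" "dim P = 2" and sc: "\<And>X. X \<in> P \<Longrightarrow> L X = k *\<^sub>R X"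
  shows "det_on P L = k\<^sup>2"
proof -
  have LP: "\<And>X. X \<in> P \<Longrightarrow> L X \<in> P"
    using sc P(1) by (simp add: subspace_scale)
  obtain e g a b c d where *: "e \<noteq> g" "independent {e, g}" "span {e, g} = P"
    "L e = a *\<^sub>R e + c *\<^sub>R g" "L g = b *\<^sub>R e + d *\<^sub>R g"
    "trace_on P L = a + d" "det_on P L = a * d - b * c"
    by (rule plane_endomorphism_matrix[OF P LP])
  have P': "e \<in> P" "g \<in> P"
    using *(3) by (auto intro: span_base)
  have e: "e \<notin> span {g}" and g: "g \<noteq> 0"
    using *(1,2) by (auto simp: independent_insert)
  have zero: "s = 0 \<and> t = 0" if 0: "s *\<^sub>R e + t *\<^sub>R g = 0" for s t
  proof -
    have "s = 0"
    proof (rule ccontr)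
      assume "s \<noteq> 0"
      have "s *\<^sub>R e = (- t) *\<^sub>R g"
        using 0 by (simp add: eq_neg_iff_add_eq_0)
      then have "inverse s *\<^sub>R (s *\<^sub>R e) \<in> span {g}"
        by (simp add: span_base span_scale span_neg)
      then show False
        using e \<open>s \<noteq> 0\<close> by simp
    qed
    then show ?thesis
      using 0 g by simp
  qed
  have "(a - k) *\<^sub>R e + c *\<^sub>R g = 0" "b *\<^sub>R e + (d - k) *\<^sub>R g = 0"
    using sc[OF P'(1)] sc[OF P'(2)] *(4,5) by (simp_all add: algebra_simps)
  then have "a = k" "c = 0" "b = 0" "d = k"
    using zero[of "a - k" c] zero[of b "d - k"] by simp_all
  then show ?thesis
    using *(7) by (simp add: power2_eq_square)
qed

text \<open>The algebraic core. Symmetry of \<open>D\<close> and of \<open>D \<circ> L\<close> turns \<open>\<langle>D (L X), L Y\<rangle>\<close> into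
  \<open>\<langle>D (L (L Y)), X\<rangle>\<close>, so that the conformality condition is a statement about \<open>L \<circ> L\<close>, which
  the Cayley--Hamilton identity expresses through trace and determinant.\<close>

lemma trace_zero_iff_conformal:
  fixes P :: "'a::euclidean_space set"
  assumes P: "subspace P" "dim P = 2" and LP: "\<And>X. X \<in> P \<Longrightarrow> L X \<in> P"
    and L: "\<And>X Y s t. X \<in> P \<Longrightarrow> Y \<in> P \<Longrightarrow> L (s *\<^sub>R X + t *\<^sub>R Y) = s *\<^sub>R L X + t *\<^sub>R L Y"
    and DP: "\<And>X. X \<in> P \<Longrightarrow> D X \<in> P"
    and D: "\<And>X Y s t. X \<in> P \<Longrightarrow> Y \<in> P \<Longrightarrow> D (s *\<^sub>R X + t *\<^sub>R Y) = s *\<^sub>R D X + t *\<^sub>R D Y"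
    and symD: "\<And>X Y. X \<in> P \<Longrightarrow> Y \<in> P \<Longrightarrow> D X \<bullet> Y = D Y \<bullet> X"
    and symDL: "\<And>X Y. X \<in> P \<Longrightarrow> Y \<in> P \<Longrightarrow> D (L X) \<bullet> Y = D (L Y) \<bullet> X"
    and detD: "det_on P D \<noteq> 0" and detL: "det_on P L < 0"
  shows "trace_on P L = 0 \<longleftrightarrow> (\<exists>r>0. \<forall>X\<in>P. \<forall>Y\<in>P. D (L X) \<bullet> L Y = r * (D X \<bullet> Y))"
proof -
  have D0: "D (k *\<^sub>R X) = k *\<^sub>R D X" if "X \<in> P" for k X
    using D[OF that that, of k 0] by simp
  have sq: "D (L X) \<bullet> L Y = D (L (L Y)) \<bullet> X" if "X \<in> P" "Y \<in> P" for X Y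
    using symDL[of X "L Y"] LP that by auto
  have "D (L X) \<bullet> L Y = - det_on P L * (D X \<bullet> Y)"
    if tr: "trace_on P L = 0" and XY: "X \<in> P" "Y \<in> P" for X Y
  proof -
    have "L (L Y) = (- det_on P L) *\<^sub>R Y"
      using cayley_hamilton_plane[OF P LP L, of Y] XY tr by simp
    then have "D (L (L Y)) = (- det_on P L) *\<^sub>R D Y"
      using D0[OF XY(2)] by metis
    then show ?thesis
      unfolding sq[OF XY] using symD[OF XY] by simp
  qed
  then have forward: "\<exists>r>0. \<forall>X\<in>P. \<forall>Y\<in>P. D (L X) \<bullet> L Y = r * (D X \<bullet> Y)" if "trace_on P L = 0"
    using that detL by (intro exI[of _ "- det_on P L"]) simp
  \<comment> \<open>By the Cayley--Hamilton identity for \<open>D\<close>, a vector of its kernel is killed by \<open>det D\<close>.\<close>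
  have inj: "Z = 0" if Z: "Z \<in> P" "\<And>X. X \<in> P \<Longrightarrow> D Z \<bullet> X = 0" for Z
  proof -
    have DZ: "D Z = 0"
      using Z(2)[OF DP[OF Z(1)]] by simp
    moreover have "D 0 = 0"
      using D0[OF Z(1), of 0] by simp
    ultimately show ?thesis
      using cayley_hamilton_plane[OF P DP D Z(1)] detD by simp
  qed
  have backward: "trace_on P L = 0"
    if conf: "\<And>X Y. X \<in> P \<Longrightarrow> Y \<in> P \<Longrightarrow> D (L X) \<bullet> L Y = r * (D X \<bullet> Y)" for r
  proof (rule ccontr)
    assume tr: "trace_on P L \<noteq> 0"
    have sqL: "L (L Y) = r *\<^sub>R Y" if Y: "Y \<in> P" for Y
    proof -
      have LLY: "L (L Y) \<in> P"
        using LP Y by blast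
      have "D (1 *\<^sub>R L (L Y) + (-r) *\<^sub>R Y) = 1 *\<^sub>R D (L (L Y)) + (-r) *\<^sub>R D Y"
        by (rule D[OF LLY Y])
      then have "D (L (L Y) - r *\<^sub>R Y) \<bullet> X = 0" if "X \<in> P" for X
        using conf[OF that Y] sq[OF that Y] symD[OF that Y] by (simp add: inner_diff_left)
      moreover have "L (L Y) - r *\<^sub>R Y \<in> P"
        using LLY Y P(1) by (simp add: subspace_diff subspace_scale)
      ultimately show ?thesis
        using inj by fastforce
    qed
    have "L Y = ((r + det_on P L) / trace_on P L) *\<^sub>R Y" if Y: "Y \<in> P" for Y
    proof -
      have "trace_on P L *\<^sub>R L Y = (r + det_on P L) *\<^sub>R Y"
        using cayley_hamilton_plane[OF P LP L Y] sqL[OF Y] by (simp add: algebra_simps)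
      then have "(inverse (trace_on P L) * trace_on P L) *\<^sub>R L Y = (inverse (trace_on P L) * (r + det_on P L)) *\<^sub>R Y"
        by (metis scaleR_scaleR)
      then show ?thesis
        using tr by (simp add: divide_inverse mult.commute)
    qed
    then show False
      using det_on_scaling[OF P] detL zero_le_power2 by (metis not_less)
  qed
  show ?thesis
    using forward backward by blast
qed

lemma range_eq_hyperplane:
  fixes T :: "real^2 \<Rightarrow> real^3"
  assumes T: "linear T" "inj T" and m: "m \<noteq> 0" "\<And>v. m \<bullet> T v = 0"
  shows "range T = {X. m \<bullet> X = 0}"
proof (rule subspace_dim_equal)
  show "subspace (range T)"
    using T(1) by (simp add: linear_subspace_image)
  show "subspace {X. m \<bullet> X = 0}"
    by (rule subspace_hyperplane)
  show "range T \<subseteq> {X. m \<bullet> X = 0}"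
    using m by auto
  have "dim (range T) = dim (UNIV :: (real^2) set)"
    using dim_image_eq[OF T(1), of UNIV] T(2) by simp
  then show "dim {X. m \<bullet> X = 0} \<le> dim (range T)"
    using dim_hyperplane[OF m(1)] by simp
qed

lemma unit_normal_unique:
  fixes u n :: "'a::real_inner"
  assumes "norm u = 1" "norm n = 1" "\<And>X. u \<bullet> X = 0 \<Longrightarrow> n \<bullet> X = 0"
  shows "n = u \<or> n = - u"
proof -
  have uu: "u \<bullet> u = 1"
    using assms(1) by (simp add: dot_square_norm)
  define X where "X = n - (n \<bullet> u) *\<^sub>R u"
  have "u \<bullet> X = 0"
    by (simp add: X_def inner_diff_right uu inner_commute)
  moreover from this have "n \<bullet> X = 0"
    by (rule assms(3))
  ultimately have "X \<bullet> X = 0"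
    by (simp add: X_def inner_diff_left)
  then have n: "n = (n \<bullet> u) *\<^sub>R u"
    by (simp add: X_def)
  then have "norm n = \<bar>n \<bullet> u\<bar> * norm u"
    using norm_scaleR[of "n \<bullet> u" u] by simp
  then have "n \<bullet> u = 1 \<or> n \<bullet> u = -1"
    using assms by auto
  then show ?thesis
    using n by auto
qed

lemma cross3_nonzero:
  fixes T :: "real^2 \<Rightarrow> real^3"
  assumes T: "linear T" "inj T"
  shows "cross3 (T (axis 1 1)) (T (axis 2 1)) \<noteq> 0"
proof
  have zero: "v = 0" if "T v = 0" for v
    using that T linear_injective_0 by blast
  have axes: "(axis 1 1 :: real^2) \<noteq> 0" "(axis 2 1 :: real^2) \<noteq> 0"
    by (simp_all add: axis_eq_0_iff)
  assume "cross3 (T (axis 1 1)) (T (axis 2 1)) = 0"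
  then have "T (axis 1 1) = 0 \<or> T (axis 2 1) = 0 \<or> (\<exists>c. T (axis 2 1) = c *\<^sub>R T (axis 1 1))"
    unfolding cross_eq_0 collinear_lemma .
  then obtain c where "T (axis 2 1) = c *\<^sub>R T (axis 1 1)"
    using zero axes by blast
  then have "T (axis 2 1 - c *\<^sub>R axis 1 1) = 0"
    by (simp only: linear_diff[OF T(1)] linear_cmul[OF T(1)] diff_self)
  then have "axis 2 1 - c *\<^sub>R (axis 1 1 :: real^2) = 0"
    by (rule zero)
  then have "(axis 2 1 - c *\<^sub>R (axis 1 1 :: real^2)) $ 2 = 0"
    by simp
  then show False
    by (simp add: axis_def)
qed

section \<open>Derivatives of smooth maps and normal fields\<close>

lemma smooth_on_differentiable:
  assumes "smooth_on S g" "x \<in> S"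
  shows "g differentiable (at x)"
  using assms unfolding smooth_on_def by (metis times_differentiable_on.simps(2))

lemma smooth_on_derivative:
  assumes "smooth_on S g"
  shows "smooth_on S (\<lambda>x. frechet_derivative g (at x) v)"
  using assms unfolding smooth_on_def by (metis times_differentiable_on.simps(2))

lemma smooth_on_continuous: "smooth_on S g \<Longrightarrow> continuous_on S g"
  unfolding smooth_on_def by (metis times_differentiable_on.simps(1))

lemma smooth_on_has_derivative:
  assumes "smooth_on S g" "x \<in> S"
  shows "(g has_derivative frechet_derivative g (at x)) (at x)"
  using smooth_on_differentiable[OF assms] frechet_derivative_works by blast

lemma has_vector_derivative_along_line:
  assumes "(g has_derivative g') (at (p + s *\<^sub>R v))"
  shows "((\<lambda>s. g (p + s *\<^sub>R v)) has_vector_derivative g' v) (at s)"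
proof -
  have "((\<lambda>s. p + s *\<^sub>R v) has_vector_derivative v) (at s)"
    by (auto intro!: derivative_eq_intros)
  then show ?thesis
    using vector_derivative_diff_chain_within[of "\<lambda>s. p + s *\<^sub>R v" v s UNIV g g'] assms
    by (auto simp: comp_def has_derivative_at_withinI)
qed

text \<open>The second difference of \<open>g\<close> over a parallelogram is \<open>t\<^sup>2\<close> times a value of the second
  derivative: the mean value theorem is applied along \<open>a\<close> and then along \<open>b\<close>. Pairing with a fixed \<open>w\<close> reduces
  vector values to real ones.\<close>

lemma mixed_difference_mvt:
  fixes g :: "'a::real_normed_vector \<Rightarrow> 'b::real_inner"
  assumes g: "\<And>y. y \<in> ball y0 r \<Longrightarrow> (g has_derivative g' y) (at y)"
    and g'a: "\<And>y. y \<in> ball y0 r \<Longrightarrow> ((\<lambda>y. g' y a) has_derivative h y) (at y)"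
    and t: "0 < t" "t * (norm a + norm b) < r"
  shows "\<exists>z. dist z y0 \<le> t * (norm a + norm b) \<and>
    w \<bullet> (g (y0 + t *\<^sub>R a + t *\<^sub>R b) - g (y0 + t *\<^sub>R a) - g (y0 + t *\<^sub>R b) + g y0) = t\<^sup>2 * (w \<bullet> h z b)"
proof -
  have dist: "dist (y0 + s *\<^sub>R a + k *\<^sub>R b) y0 \<le> t * (norm a + norm b)"
    if "0 \<le> s" "s \<le> t" "0 \<le> k" "k \<le> t" for s k
  proof -
    have "dist (y0 + s *\<^sub>R a + k *\<^sub>R b) y0 \<le> norm (s *\<^sub>R a) + norm (k *\<^sub>R b)"
      by (simp add: dist_norm add.assoc norm_triangle_ineq flip: norm_scaleR)
    also have "\<dots> \<le> t * norm a + t * norm b"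
      using that by (simp add: add_mono mult_right_mono)
    finally show ?thesis by (simp add: algebra_simps)
  qed
  have ball: "y0 + s *\<^sub>R a + k *\<^sub>R b \<in> ball y0 r"
    if "0 \<le> s" "s \<le> t" "0 \<le> k" "k \<le> t" for s k
    using dist[OF that] t by (simp add: dist_commute)
  define \<phi> where "\<phi> s = w \<bullet> (g (y0 + t *\<^sub>R b + s *\<^sub>R a) - g (y0 + s *\<^sub>R a))" for s
  have "\<exists>s>0. s < t \<and> \<phi> t - \<phi> 0 = (t - 0) * (w \<bullet> (g' (y0 + t *\<^sub>R b + s *\<^sub>R a) a - g' (y0 + s *\<^sub>R a) a))"
  proof (rule MVT2[OF t(1)])
    fix s assume s: "0 \<le> s" "s \<le> t"
    have "y0 + t *\<^sub>R b + s *\<^sub>R a \<in> ball y0 r" "y0 + s *\<^sub>R a \<in> ball y0 r"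
      using ball[of s t] ball[of s 0] s t by (auto simp: algebra_simps)
    from this[THEN g, THEN has_vector_derivative_along_line]
    show "(\<phi> has_real_derivative w \<bullet> (g' (y0 + t *\<^sub>R b + s *\<^sub>R a) a - g' (y0 + s *\<^sub>R a) a)) (at s)"
      unfolding \<phi>_def has_real_derivative_iff_has_vector_derivative
      by (intro bounded_linear.has_vector_derivative[OF bounded_linear_inner_right] has_vector_derivative_diff)
  qed
  then obtain s where s: "0 < s" "s < t"
    and \<phi>: "\<phi> t - \<phi> 0 = t * (w \<bullet> (g' (y0 + t *\<^sub>R b + s *\<^sub>R a) a - g' (y0 + s *\<^sub>R a) a))" by auto
  define \<psi> where "\<psi> k = w \<bullet> g' (y0 + s *\<^sub>R a + k *\<^sub>R b) a" for k
  have "\<exists>k>0. k < t \<and> \<psi> t - \<psi> 0 = (t - 0) * (w \<bullet> h (y0 + s *\<^sub>R a + k *\<^sub>R b) b)"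
  proof (rule MVT2[OF t(1)])
    fix k assume k: "0 \<le> k" "k \<le> t"
    have "y0 + s *\<^sub>R a + k *\<^sub>R b \<in> ball y0 r"
      using s k by (intro ball) auto
    from this[THEN g'a, THEN has_vector_derivative_along_line]
    show "(\<psi> has_real_derivative w \<bullet> h (y0 + s *\<^sub>R a + k *\<^sub>R b) b) (at k)"
      unfolding \<psi>_def has_real_derivative_iff_has_vector_derivative
      by (intro bounded_linear.has_vector_derivative[OF bounded_linear_inner_right])
  qed
  then obtain k where k: "0 < k" "k < t" "\<psi> t - \<psi> 0 = t * (w \<bullet> h (y0 + s *\<^sub>R a + k *\<^sub>R b) b)" by auto
  have "\<phi> t - \<phi> 0 = t\<^sup>2 * (w \<bullet> h (y0 + s *\<^sub>R a + k *\<^sub>R b) b)"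
    using \<phi> k(3) by (simp add: \<psi>_def inner_diff_right power2_eq_square add_ac)
  then show ?thesis
    using dist[of s k] s k(1,2)
    by (intro exI[of _ "y0 + s *\<^sub>R a + k *\<^sub>R b"]) (simp add: \<phi>_def add_ac inner_diff_right inner_add_right)
qed

text \<open>Schwarz's theorem: the second difference is symmetric in the two directions, so both iterated
  derivatives, paired with a fixed \<open>w\<close>, take a common value at two points arbitrarily close to
  \<open>y0\<close>; continuity does the rest.\<close>

lemma second_derivative_symmetric:
  fixes g :: "'a::real_normed_vector \<Rightarrow> 'b::real_inner"
  assumes S: "open S" "y0 \<in> S" and g: "smooth_on S g"
  shows "frechet_derivative (\<lambda>y. frechet_derivative g (at y) a) (at y0) b
       = frechet_derivative (\<lambda>y. frechet_derivative g (at y) b) (at y0) a"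
proof -
  define H where "H a b y = frechet_derivative (\<lambda>y. frechet_derivative g (at y) a) (at y) b" for a b y
  \<comment> \<open>With this choice of \<open>w\<close>, the equation of the paired values says \<open>w \<bullet> w = 0\<close>.\<close>
  define w where "w = H a b y0 - H b a y0"
  have "w \<bullet> H a b y0 = w \<bullet> H b a y0"
  proof (rule ccontr)
    assume "w \<bullet> H a b y0 \<noteq> w \<bullet> H b a y0"
    define \<epsilon> where "\<epsilon> = dist (w \<bullet> H a b y0) (w \<bullet> H b a y0) / 2"
    have \<epsilon>: "0 < \<epsilon>"
      using \<open>w \<bullet> H a b y0 \<noteq> w \<bullet> H b a y0\<close> by (simp add: \<epsilon>_def)
    have near: "\<forall>\<^sub>F y in at y0. dist (w \<bullet> H a b y) (w \<bullet> H a b y0) < \<epsilon>" for a b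
    proof -
      have "smooth_on S (H a b)"
        unfolding H_def by (intro smooth_on_derivative g)
      then have "isCont (H a b) y0"
        using smooth_on_continuous S continuous_on_eq_continuous_at by blast
      then have "isCont (\<lambda>y. w \<bullet> H a b y) y0"
        by (intro continuous_intros)
      then show ?thesis
        using \<epsilon> unfolding isCont_def tendsto_iff by blast
    qed
    have "\<forall>\<^sub>F y in at y0. y \<in> S"
      using S by (simp add: eventually_at_in_open')
    from eventually_conj[OF this eventually_conj[OF near[of a b] near[of b a]]]
    obtain r where r: "0 < r" "\<And>y. y \<noteq> y0 \<Longrightarrow> dist y y0 < r \<Longrightarrow> y \<in> S \<and>
       dist (w \<bullet> H a b y) (w \<bullet> H a b y0) < \<epsilon> \<and> dist (w \<bullet> H b a y) (w \<bullet> H b a y0) < \<epsilon>"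
      unfolding eventually_at by auto
    have r': "y \<in> S \<and> dist (w \<bullet> H a b y) (w \<bullet> H a b y0) < \<epsilon> \<and> dist (w \<bullet> H b a y) (w \<bullet> H b a y0) < \<epsilon>"
      if "dist y y0 < r" for y
      using r(2)[OF _ that] S \<epsilon> by (cases "y = y0") auto
    \<comment> \<open>Any positive \<open>t\<close> with \<open>t * (norm a + norm b) < r\<close> does; the summand 1 covers \<open>a = b = 0\<close>.\<close>
    define t where "t = r / (norm a + norm b + 1) / 2"
    have pos: "0 < norm a + norm b + 1"
      by (simp add: add_nonneg_pos)
    have t0: "0 < t"
      using r(1) pos by (simp add: t_def)
    have "t * (norm a + norm b) < t * (2 * (norm a + norm b + 1))"
      using t0 by (intro mult_strict_left_mono) (auto simp: add_nonneg_pos intro: add_nonneg_nonneg)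
    also have "\<dots> = r"
      using pos by (simp add: t_def field_simps)
    finally have t: "t * (norm a + norm b) < r" .
    have der: "(g has_derivative frechet_derivative g (at y)) (at y)"
      "((\<lambda>y. frechet_derivative g (at y) c) has_derivative (\<lambda>b. H c b y)) (at y)"
      if "y \<in> ball y0 r" for y c
    proof -
      have y: "y \<in> S"
        using r' that by (simp add: dist_commute)
      then show "(g has_derivative frechet_derivative g (at y)) (at y)"
        by (rule smooth_on_has_derivative[OF g])
      show "((\<lambda>y. frechet_derivative g (at y) c) has_derivative (\<lambda>b. H c b y)) (at y)"
        unfolding H_def by (rule smooth_on_has_derivative[OF smooth_on_derivative[OF g] y])
    qed
    obtain z where z: "dist z y0 \<le> t * (norm a + norm b)"
      "w \<bullet> (g (y0 + t *\<^sub>R a + t *\<^sub>R b) - g (y0 + t *\<^sub>R a) - g (y0 + t *\<^sub>R b) + g y0) = t\<^sup>2 * (w \<bullet> H a b z)"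
      using mixed_difference_mvt[where g = g and h = "\<lambda>y b. H a b y", OF der t0 t, where w = w] by blast
    obtain z' where z': "dist z' y0 \<le> t * (norm b + norm a)"
      "w \<bullet> (g (y0 + t *\<^sub>R b + t *\<^sub>R a) - g (y0 + t *\<^sub>R b) - g (y0 + t *\<^sub>R a) + g y0) = t\<^sup>2 * (w \<bullet> H b a z')"
      using mixed_difference_mvt[where g = g and h = "\<lambda>y a. H b a y" and a = b and b = a, OF der t0, where w = w] t
      by (auto simp: add.commute)
    have "t\<^sup>2 * (w \<bullet> H a b z) = t\<^sup>2 * (w \<bullet> H b a z')"
      unfolding z(2)[symmetric] z'(2)[symmetric] by (simp add: algebra_simps)
    then have eq: "w \<bullet> H a b z = w \<bullet> H b a z'"
      using t0 by simp
    have "dist z y0 < r" "dist z' y0 < r"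
      using z(1) z'(1) t by (auto simp: add.commute)
    then have "dist (w \<bullet> H a b z) (w \<bullet> H a b y0) < \<epsilon>" "dist (w \<bullet> H a b z) (w \<bullet> H b a y0) < \<epsilon>"
      using r'[of z] r'[of z'] by (auto simp: eq)
    then have "dist (w \<bullet> H a b y0) (w \<bullet> H b a y0) < 2 * \<epsilon>"
      by (simp add: dist_real_def)
    then show False
      by (simp add: \<epsilon>_def)
  qed
  then have "w \<bullet> w = 0"
    by (simp add: w_def inner_diff_right)
  then show ?thesis
    by (simp add: w_def H_def)
qed

text \<open>Symmetry of the second fundamental form: differentiating \<open>\<langle>n, dx b\<rangle> = 0\<close> in direction \<open>a\<close>
  expresses \<open>\<langle>n' a, dx b\<rangle>\<close> through the second derivative of \<open>x\<close>.\<close>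

lemma normal_derivative_symmetric:
  fixes x :: "'a::real_normed_vector \<Rightarrow> 'b::real_inner"
  assumes V: "open V" "y0 \<in> V" and x: "smooth_on V x"
    and n: "(n has_derivative n') (at y0)"
    and normal: "\<And>y v. y \<in> V \<Longrightarrow> n y \<bullet> frechet_derivative x (at y) v = 0"
  shows "n' a \<bullet> frechet_derivative x (at y0) b = n' b \<bullet> frechet_derivative x (at y0) a"
proof -
  let ?H = "\<lambda>a. frechet_derivative (\<lambda>y. frechet_derivative x (at y) a) (at y0)"
  have eq: "n y0 \<bullet> ?H b a + n' a \<bullet> frechet_derivative x (at y0) b = 0" for a b
  proof -
    have "((\<lambda>y. frechet_derivative x (at y) b) has_derivative ?H b) (at y0)" for b
      using smooth_on_has_derivative[OF smooth_on_derivative[OF x] V(2)] .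
    from has_derivative_inner[OF n this[of b]]
    have "((\<lambda>y. n y \<bullet> frechet_derivative x (at y) b) has_derivative
        (\<lambda>a. n y0 \<bullet> ?H b a + n' a \<bullet> frechet_derivative x (at y0) b)) (at y0)" .
    moreover have "((\<lambda>y. n y \<bullet> frechet_derivative x (at y) b) has_derivative (\<lambda>a. 0)) (at y0)"
      by (rule has_derivative_transform_within_open[OF has_derivative_const[of 0] V]) (simp add: normal)
    ultimately show ?thesis
      by (rule fun_cong[OF has_derivative_unique])
  qed
  show ?thesis
    using eq[of b a] eq[of a b] second_derivative_symmetric[OF V x, of a b] by simp
qed

lemma unit_field_derivative:
  fixes n :: "'a::real_normed_vector \<Rightarrow> 'b::real_inner"
  assumes V: "open V" "y0 \<in> V" and n: "(n has_derivative n') (at y0)" "\<And>y. y \<in> V \<Longrightarrow> norm (n y) = 1"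
  shows "n y0 \<bullet> n' a = 0"
proof -
  have "((\<lambda>y. n y \<bullet> n y) has_derivative (\<lambda>a. n y0 \<bullet> n' a + n' a \<bullet> n y0)) (at y0)"
    by (rule has_derivative_inner[OF n(1) n(1)])
  moreover have "((\<lambda>y. n y \<bullet> n y) has_derivative (\<lambda>a. 0)) (at y0)"
    by (rule has_derivative_transform_within_open[OF has_derivative_const[of 1] V]) (simp add: n(2) dot_square_norm)
  ultimately have "n y0 \<bullet> n' a + n' a \<bullet> n y0 = 0"
    by (rule fun_cong[OF has_derivative_unique])
  then show ?thesis
    by (simp add: inner_commute)
qed

text \<open>A continuous map \<open>h\<close> is differentiable as soon as its composition with an immersion is. With
  a left inverse \<open>T\<close> of \<open>x'\<close>, the increments satisfy \<open>\<Delta>h = T \<Delta>g + o(\<Delta>h)\<close>; this first bounds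
  \<open>\<Delta>h\<close> by a multiple of \<open>\<Delta>y\<close>, and then makes the error term \<open>o(\<Delta>y)\<close>.\<close>

lemma has_derivative_factor_immersion:
  fixes x :: "'b::euclidean_space \<Rightarrow> 'c::euclidean_space" and h :: "'a::real_normed_vector \<Rightarrow> 'b"
  assumes x: "(x has_derivative x') (at (h y0))" "inj x'"
    and g: "(g has_derivative g') (at y0)" and eq: "\<forall>\<^sub>F y in nhds y0. x (h y) = g y"
    and h: "isCont h y0"
  shows "\<exists>h'. (h has_derivative h') (at y0)"
proof -
  have "linear x'"
    using x(1) has_derivative_linear by blast
  then obtain T where T: "linear T" "T \<circ> x' = id"
    using linear_injective_left_inverse x(2) by blast
  obtain B where B: "0 < B" "\<And>v. norm (T v) \<le> B * norm v"
    using linear_bounded_pos[OF T(1)] by blast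
  obtain C where C: "0 < C" "\<And>v. norm (g' v) \<le> C * norm v"
    using bounded_linear.pos_bounded[OF has_derivative_bounded_linear[OF g]] by (auto simp: mult.commute)
  have eq0: "x (h y0) = g y0"
    using eventually_nhds_x_imp_x[OF eq] .
  have approx: "\<forall>\<^sub>F y in nhds y0. norm (h y - h y0 - T (g y - g y0)) \<le> e * norm (h y - h y0)"
    if e: "0 < e" for e
  proof -
    have "0 < e / B"
      using e B by simp
    then have "\<forall>\<^sub>F z in nhds (h y0). norm (x z - x (h y0) - x' (z - h y0)) \<le> e / B * norm (z - h y0)"
      using x(1) unfolding has_derivative_at_alt eventually_nhds_metric dist_norm by blast
    moreover have "filterlim h (nhds (h y0)) (nhds y0)"
      using h by (simp add: continuous_at tendsto_at_iff_tendsto_nhds isCont_def)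
    ultimately have "\<forall>\<^sub>F y in nhds y0. norm (x (h y) - x (h y0) - x' (h y - h y0)) \<le> e / B * norm (h y - h y0)"
      by (rule eventually_compose_filterlim)
    with eq show ?thesis
    proof eventually_elim
      case (elim y)
      have "T (x' (h y - h y0)) = h y - h y0"
        using T(2) by (metis comp_apply id_apply)
      then have "h y - h y0 - T (g y - g y0) = - T (x (h y) - x (h y0) - x' (h y - h y0))"
        using elim(1) eq0 by (simp add: linear_diff[OF T(1)])
      then have "norm (h y - h y0 - T (g y - g y0)) \<le> B * norm (x (h y) - x (h y0) - x' (h y - h y0))"
        using B(2) by simp
      also have "\<dots> \<le> B * (e / B * norm (h y - h y0))"
        using elim(2) B(1) by (intro mult_left_mono) auto
      finally show ?case
        using B(1) by simp
    qed
  qed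
  have g_approx: "\<forall>\<^sub>F y in nhds y0. norm (g y - g y0 - g' (y - y0)) \<le> e * norm (y - y0)" if "0 < e" for e
    using g that unfolding has_derivative_at_alt eventually_nhds_metric dist_norm by blast
  have "(h has_derivative (\<lambda>v. T (g' v))) (at y0)"
    unfolding has_derivative_at_alt
  proof (intro conjI allI impI)
    show "bounded_linear (\<lambda>v. T (g' v))"
      using bounded_linear_compose[of T g'] T(1) has_derivative_bounded_linear[OF g]
      by (simp add: linear_conv_bounded_linear)
    fix e :: real assume e: "0 < e"
    \<comment> \<open>Since \<open>e1\<close> is at most 1/2, \<open>norm dh\<close> is at most \<open>2 * B * norm dg\<close>, hence at most
      \<open>2 * B * (C + 1) * norm (y - y0)\<close>; the other bound on \<open>e1\<close> makes the first error term at
      most half of the allowed one, and \<open>e2\<close> does the same for the second.\<close>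
    define e1 where "e1 = min (1 / 2) (e / (4 * B * (C + 1)))"
    have e1: "0 < e1" "e1 \<le> 1 / 2" "e1 * (4 * B * (C + 1)) \<le> e"
    proof -
      have pos: "0 < 4 * B * (C + 1)"
        using B(1) C(1) by simp
      then show "0 < e1" "e1 \<le> 1 / 2"
        using e by (auto simp: e1_def)
      have "e1 \<le> e / (4 * B * (C + 1))"
        by (simp add: e1_def)
      then show "e1 * (4 * B * (C + 1)) \<le> e"
        using pos by (simp add: pos_le_divide_eq)
    qed
    define e2 where "e2 = e / (2 * B)"
    have e2: "0 < e2" "B * e2 = e / 2"
      using e B(1) by (auto simp: e2_def)
    have "\<forall>\<^sub>F y in nhds y0. norm (h y - h y0 - T (g' (y - y0))) \<le> e * norm (y - y0)"
      using approx[OF e1(1)] g_approx[OF e2(1)] g_approx[of 1, OF zero_less_one]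
    proof eventually_elim
      case (elim y)
      define dh where "dh = h y - h y0"
      define dg where "dg = g y - g y0"
      have "norm dg \<le> norm (dg - g' (y - y0)) + norm (g' (y - y0))"
        by (metis diff_add_cancel norm_triangle_ineq)
      then have dg: "norm dg \<le> (C + 1) * norm (y - y0)"
        using elim(3) C(2)[of "y - y0"] by (simp add: dg_def algebra_simps)
      have "norm dh \<le> norm (dh - T dg) + norm (T dg)"
        by (metis diff_add_cancel norm_triangle_ineq)
      also have "\<dots> \<le> 1 / 2 * norm dh + B * norm dg"
        using elim(1) mult_right_mono[OF e1(2), of "norm dh"] B(2)[of dg] by (simp add: dh_def dg_def)
      finally have "norm dh \<le> 2 * B * norm dg"
        by simp
      also have "\<dots> \<le> 2 * B * ((C + 1) * norm (y - y0))"
        using dg B(1) by (intro mult_left_mono) auto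
      finally have "e1 * norm dh \<le> e1 * (2 * B * ((C + 1) * norm (y - y0)))"
        using e1(1) by (intro mult_left_mono) auto
      also have "\<dots> = e1 * (4 * B * (C + 1)) / 2 * norm (y - y0)"
        by (simp add: field_simps)
      also have "\<dots> \<le> e / 2 * norm (y - y0)"
        using divide_right_mono[OF e1(3), of 2] by (intro mult_right_mono) simp_all
      finally have 1: "norm (dh - T dg) \<le> e / 2 * norm (y - y0)"
        using elim(1) by (simp add: dh_def dg_def)
      have "norm (T (dg - g' (y - y0))) \<le> B * (e2 * norm (y - y0))"
        using order_trans[OF B(2) mult_left_mono[OF elim(2), of B]] B(1) by (simp add: dg_def)
      then have 2: "norm (T (dg - g' (y - y0))) \<le> e / 2 * norm (y - y0)"
        using e2(2) by (simp flip: mult.assoc)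
      have "dh - T (g' (y - y0)) = (dh - T dg) + T (dg - g' (y - y0))"
        by (simp add: linear_diff[OF T(1)])
      then have "norm (dh - T (g' (y - y0))) \<le> norm (dh - T dg) + norm (T (dg - g' (y - y0)))"
        by (metis norm_triangle_ineq)
      then show ?case
        using 1 2 by (simp add: dh_def)
    qed
    then show "\<exists>d>0. \<forall>y. norm (y - y0) < d \<longrightarrow> norm (h y - h y0 - T (g' (y - y0))) \<le> e * norm (y - y0)"
      unfolding eventually_nhds_metric dist_norm .
  qed
  then show ?thesis by blast
qed

section \<open>Supporting planes of the unit ball of a norm\<close>

locale minkowski_norm =
  fixes N :: "'a::euclidean_space \<Rightarrow> real"
  assumes is_norm: "is_norm N"
begin

lemma N_scale: "N (c *\<^sub>R x) = \<bar>c\<bar> * N x"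
  using is_norm by (simp add: is_norm_def)

lemma N_triangle: "N (x + y) \<le> N x + N y"
  using is_norm by (simp add: is_norm_def)

lemma N_eq_0: "N x = 0 \<longleftrightarrow> x = 0"
  using is_norm by (simp add: is_norm_def)

lemma N_nonneg: "0 \<le> N x"
  using N_triangle[of x "(-1) *\<^sub>R x"] N_scale[of "-1" x] N_eq_0[of 0] by simp

lemma convex_open_ball: "convex {x. N x < 1}"
proof (rule convexI, clarify)
  fix x y and u v :: real
  assume *: "N x < 1" "N y < 1" "0 \<le> u" "0 \<le> v" "u + v = 1"
  have "N (u *\<^sub>R x + v *\<^sub>R y) \<le> u * N x + v * N y"
    using N_triangle[of "u *\<^sub>R x" "v *\<^sub>R y"] * by (simp add: N_scale)
  also have "\<dots> < 1"
    using convex_bound_lt[OF *(1,2,3,4,5)] .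
  finally show "N (u *\<^sub>R x + v *\<^sub>R y) < 1" .
qed

text \<open>For nonzero \<open>n\<close>: the hyperplane through \<open>q\<close> with normal \<open>n\<close> supports the closed unit ball of \<open>N\<close>.\<close>

definition supports :: "'a \<Rightarrow> 'a \<Rightarrow> bool" where
  "supports n q \<longleftrightarrow> (\<forall>x. N x \<le> 1 \<longrightarrow> n \<bullet> x \<le> n \<bullet> q)"

text \<open>Points of the closed ball are limits of points \<open>s x\<close> of the open ball, and the open ball
  contains a small positive multiple of \<open>m\<close>.\<close>

lemma supports_separating:
  assumes m: "m \<noteq> 0" and sep: "\<And>x. N x < 1 \<Longrightarrow> m \<bullet> x \<le> m \<bullet> q"
  shows "supports m q" "0 < m \<bullet> q"
proof -
  show "supports m q"
    unfolding supports_def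
  proof (intro allI impI)
    fix x assume x: "N x \<le> 1"
    have "((\<lambda>s. m \<bullet> (s *\<^sub>R x)) \<longlongrightarrow> m \<bullet> (1 *\<^sub>R x)) (at_left 1)"
      by (intro tendsto_intros)
    moreover have "\<forall>\<^sub>F s in at_left 1. m \<bullet> (s *\<^sub>R x) \<le> m \<bullet> q"
      using eventually_at_left_real[OF zero_less_one]
    proof eventually_elim
      case (elim s)
      have "N (s *\<^sub>R x) = s * N x"
        using elim by (simp add: N_scale)
      also have "\<dots> \<le> s * 1"
        using x elim by (intro mult_left_mono) auto
      also have "\<dots> < 1"
        using elim by simp
      finally have "N (s *\<^sub>R x) < 1" .
      then show ?case by (rule sep)
    qed
    ultimately have "m \<bullet> (1 *\<^sub>R x) \<le> m \<bullet> q"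
      by (rule tendsto_upperbound) simp
    then show "m \<bullet> x \<le> m \<bullet> q"
      by simp
  qed
  define k where "k = 1 / (N m + 1)"
  have k: "0 < k" "k * N m < 1"
    using N_nonneg[of m] by (auto simp: k_def divide_simps)
  then have "N (k *\<^sub>R m) < 1"
    by (simp add: N_scale)
  then have "m \<bullet> (k *\<^sub>R m) \<le> m \<bullet> q"
    by (rule sep)
  moreover have "0 < m \<bullet> (k *\<^sub>R m)"
    using k m by simp
  ultimately show "0 < m \<bullet> q" by linarith
qed

text \<open>Hahn--Banach separation of the open ball from a convex set \<open>T\<close> touching it. For \<open>T = {q}\<close> this
  is the existence of supporting planes; for a line \<open>T\<close>, the supporting plane contains the line.\<close>

lemma support_separating_convex:
  assumes T: "convex T" "q \<in> T" "\<And>x. x \<in> T \<Longrightarrow> 1 \<le> N x" and q: "N q = 1"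
  obtains m where "norm m = 1" "supports m q" "0 < m \<bullet> q" "\<And>x. x \<in> T \<Longrightarrow> m \<bullet> q \<le> m \<bullet> x"
proof -
  have "(0::'a) \<in> {x. N x < 1}"
    using N_eq_0[of 0] by simp
  then have "{x. N x < 1} \<noteq> {}" "T \<noteq> {}"
    using T(2) by blast+
  moreover have "{x. N x < 1} \<inter> T = {}"
    using T(3) by force
  ultimately obtain a b where "a \<noteq> 0" "\<forall>x\<in>{x. N x < 1}. a \<bullet> x \<le> b" "\<forall>x\<in>T. b \<le> a \<bullet> x"
    using separating_hyperplane_sets[OF convex_open_ball T(1)] by blast
  then have ab: "a \<noteq> 0" "\<And>x. N x < 1 \<Longrightarrow> a \<bullet> x \<le> b" "\<And>x. x \<in> T \<Longrightarrow> b \<le> a \<bullet> x"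
    by simp_all
  have "supports a q"
    by (rule supports_separating[OF ab(1)]) (rule order_trans[OF ab(2) ab(3)[OF T(2)]])
  have "0 < a \<bullet> q"
    by (rule supports_separating[OF ab(1)]) (rule order_trans[OF ab(2) ab(3)[OF T(2)]])
  have bq: "a \<bullet> q \<le> b"
  proof -
    have "((\<lambda>s. a \<bullet> (s *\<^sub>R q)) \<longlongrightarrow> a \<bullet> (1 *\<^sub>R q)) (at_left 1)"
      by (intro tendsto_intros)
    moreover have "\<forall>\<^sub>F s in at_left 1. a \<bullet> (s *\<^sub>R q) \<le> b"
      using eventually_at_left_real[OF zero_less_one]
    proof eventually_elim
      case (elim s)
      then show ?case
        by (intro ab(2)) (simp add: N_scale q)
    qed
    ultimately have "a \<bullet> (1 *\<^sub>R q) \<le> b"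
      by (rule tendsto_upperbound) simp
    then show ?thesis
      by simp
  qed
  show ?thesis
  proof (rule that[of "a /\<^sub>R norm a"])
    show "norm (a /\<^sub>R norm a) = 1"
      using ab(1) by simp
    show "supports (a /\<^sub>R norm a) q"
      using \<open>supports a q\<close> ab(1) by (simp add: supports_def)
    show "0 < (a /\<^sub>R norm a) \<bullet> q"
      using \<open>0 < a \<bullet> q\<close> ab(1) by simp
    show "(a /\<^sub>R norm a) \<bullet> q \<le> (a /\<^sub>R norm a) \<bullet> x" if "x \<in> T" for x
    proof -
      have "a \<bullet> q \<le> a \<bullet> x"
        using bq ab(3)[OF that] by linarith
      then show ?thesis
        using ab(1) by simp
    qed
  qed
qed

text \<open>If \<open>x\<close> in the ball lay beyond the slab bounded by \<open>v + P\<close> and \<open>- v + P\<close>, a multiple of \<open>x\<close> by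
  a factor of modulus less than 1 would lie in \<open>v + P\<close>, where the norm is at least \<open>N v\<close>.\<close>

lemma birkhoff_orthogonal_supports:
  assumes P: "\<And>x. x \<in> P \<longleftrightarrow> n \<bullet> x = 0" and v: "N v = 1" "birkhoff_orthogonal N v P" and x: "N x \<le> 1"
  shows "\<bar>n \<bullet> x\<bar> \<le> \<bar>n \<bullet> v\<bar>"
proof (rule ccontr)
  assume "\<not> ?thesis"
  then have less: "\<bar>n \<bullet> v\<bar> < \<bar>n \<bullet> x\<bar>" by simp
  define s where "s = (n \<bullet> v) / (n \<bullet> x)"
  have s: "\<bar>s\<bar> < 1" "s * (n \<bullet> x) = n \<bullet> v"
    using less by (auto simp: s_def)
  then have "s *\<^sub>R x - v \<in> P"
    by (simp add: P inner_diff_right)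
  then have "N v \<le> N (v + 1 *\<^sub>R (s *\<^sub>R x - v))"
    using v(2) unfolding birkhoff_orthogonal_def by blast
  also have "\<dots> = \<bar>s\<bar> * N x"
    by (simp add: N_scale)
  also have "\<dots> \<le> \<bar>s\<bar> * 1"
    using x by (intro mult_left_mono) auto
  also have "\<dots> < 1"
    using s(1) by simp
  finally show False using v(1) by simp
qed

end

section \<open>The unit sphere of an admissible norm\<close>

locale admissible_norm =
  fixes N :: "real^3 \<Rightarrow> real"
  assumes admissible: "admissible N"
begin

sublocale minkowski_norm N
  using admissible by unfold_locales (simp add: admissible_def)

abbreviation "\<S> \<equiv> unit_sphere N"

lemma sphere_iff: "q \<in> \<S> \<longleftrightarrow> N q = 1"
  by (simp add: unit_sphere_def)

lemma embedded_chartD: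
  assumes "(U, \<phi>) \<in> embedded_charts \<S>"
  shows "openin (top_of_set \<S>) U" "open (\<phi> ` U)" "continuous_on U \<phi>" "inj_on \<phi> U"
    "smooth_on (\<phi> ` U) (inv_into U \<phi>)"
    "\<And>y. y \<in> \<phi> ` U \<Longrightarrow> linear (frechet_derivative (inv_into U \<phi>) (at y))"
    "\<And>y. y \<in> \<phi> ` U \<Longrightarrow> inj (frechet_derivative (inv_into U \<phi>) (at y))"
    "\<And>y. y \<in> \<phi> ` U \<Longrightarrow> inv_into U \<phi> y \<in> \<S>"
proof -
  have U: "openin (top_of_set \<S>) U"
    and hom: "homeomorphic_map (subtopology (top_of_set \<S>) U) (top_of_set (\<phi> ` U)) \<phi>"
    and 5: "smooth_on (\<phi> ` U) (inv_into U \<phi>)"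
    using assms by (auto simp: embedded_charts_def is_chart_def)
  have US: "U \<subseteq> \<S>"
    using U openin_imp_subset by blast
  then have sub: "subtopology (top_of_set \<S>) U = top_of_set U"
    by (simp add: subtopology_subtopology Int_absorb1)
  show "openin (top_of_set \<S>) U" by fact
  show "open (\<phi> ` U)"
    using assms by (auto simp: embedded_charts_def is_chart_def)
  show "continuous_on U \<phi>"
    using homeomorphic_imp_continuous_map[OF hom] unfolding sub by auto
  show "inj_on \<phi> U"
    using homeomorphic_imp_injective_map[OF hom] US by (simp add: Int_absorb1)
  show "smooth_on (\<phi> ` U) (inv_into U \<phi>)" by fact
  fix y assume y: "y \<in> \<phi> ` U"
  show "linear (frechet_derivative (inv_into U \<phi>) (at y))"
    using smooth_on_differentiable[OF 5 y] by (rule linear_frechet_derivative)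
  show "inj (frechet_derivative (inv_into U \<phi>) (at y))"
    using assms y by (auto simp: embedded_charts_def)
  show "inv_into U \<phi> y \<in> \<S>"
    using y US by (meson inv_into_into subsetD)
qed

text \<open>The linear form \<open>\<langle>m, -\<rangle>\<close> restricted to the sphere is maximal at a point supported by \<open>m\<close>, so its
  derivative vanishes there. Consequently the tangent plane does not depend on the chart.\<close>

lemma embedded_chart_range:
  assumes c: "(U, \<phi>) \<in> embedded_charts \<S>" and y: "y \<in> \<phi> ` U"
    and m: "m \<noteq> 0" "supports m (inv_into U \<phi> y)"
  shows "range (frechet_derivative (inv_into U \<phi>) (at y)) = {X. m \<bullet> X = 0}"
proof (rule range_eq_hyperplane)
  let ?x = "inv_into U \<phi>"
  show "linear (frechet_derivative ?x (at y))" "inj (frechet_derivative ?x (at y))"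
    using embedded_chartD[OF c] y by auto
  show "m \<noteq> 0" by fact
  have "((\<lambda>z. m \<bullet> ?x z) has_derivative (\<lambda>v. m \<bullet> frechet_derivative ?x (at y) v)) (at y)"
    by (intro has_derivative_inner_right smooth_on_has_derivative[OF embedded_chartD(5)[OF c] y])
  moreover have "m \<bullet> ?x z \<le> m \<bullet> ?x y" if "z \<in> \<phi> ` U" for z
    using m(2) embedded_chartD(8)[OF c that] by (simp add: supports_def sphere_iff)
  ultimately have "(\<lambda>v. m \<bullet> frechet_derivative ?x (at y) v) = (\<lambda>v. 0)"
    by (intro differential_zero_maxmin[OF y embedded_chartD(2)[OF c]]) auto
  then show "m \<bullet> frechet_derivative ?x (at y) v = 0" for v
    by metis
qed

lemma chart_at_sphere:
  assumes "q \<in> \<S>"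
  obtains U \<phi> where "chart_at (embedded_charts \<S>) q = (U, \<phi>)" "(U, \<phi>) \<in> embedded_charts \<S>" "q \<in> U"
    "\<phi> q \<in> \<phi> ` U" "inv_into U \<phi> (\<phi> q) = q"
proof -
  obtain U \<phi> where c: "chart_at (embedded_charts \<S>) q = (U, \<phi>)"
    by force
  have "\<exists>c. c \<in> embedded_charts \<S> \<and> q \<in> fst c"
    using admissible assms unfolding admissible_def embedded_surface_def by blast
  from someI_ex[OF this] have "(U, \<phi>) \<in> embedded_charts \<S>" "q \<in> U"
    using c by (auto simp: chart_at_def)
  then show ?thesis
    using that c embedded_chartD(4) by auto
qed

lemma sphere_tangent_eq:
  assumes q: "q \<in> \<S>" and m: "m \<noteq> 0" "supports m q"
  shows "sphere_tangent N q = {X. m \<bullet> X = 0}"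
proof -
  obtain U \<phi> where c: "chart_at (embedded_charts \<S>) q = (U, \<phi>)" "(U, \<phi>) \<in> embedded_charts \<S>"
    "\<phi> q \<in> \<phi> ` U" "inv_into U \<phi> (\<phi> q) = q"
    using chart_at_sphere[OF q] by metis
  have "(\<lambda>x. x) \<circ> inv_into U \<phi> = inv_into U \<phi>"
    by auto
  then show ?thesis
    using embedded_chart_range[OF c(2,3), of m] c m
    by (simp add: sphere_tangent_def tangent_plane_def differential_def in_chart_def)
qed

text \<open>The outward direction \<open>n\<close> leaves the ball at once. For the uniqueness of \<open>u_inv\<close> the opposite
  normal has to be excluded: if \<open>- n\<close> left the ball too, convexity would keep the whole normal line
  outside the open ball, and a supporting plane containing this line would have to be the tangent
  plane, to which \<open>n\<close> is orthogonal.\<close>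

lemma u_inv_eq:
  assumes q: "q \<in> \<S>" and n: "norm n = 1" "supports n q"
  shows "u_inv N q = n"
  unfolding u_inv_def
proof (rule the_equality)
  have n0: "n \<noteq> 0"
    using n(1) by auto
  have tan: "sphere_tangent N q = {X. n \<bullet> X = 0}"
    by (rule sphere_tangent_eq[OF q n0 n(2)])
  have out: "N (q + t *\<^sub>R n) > 1" if "t > 0" for t
  proof (rule ccontr)
    assume "\<not> ?thesis"
    then have "n \<bullet> (q + t *\<^sub>R n) \<le> n \<bullet> q"
      using n(2) by (simp add: supports_def)
    then show False
      using that n(1) by (simp add: inner_add_right dot_square_norm)
  qed
  then show "norm n = 1 \<and> (\<forall>X\<in>sphere_tangent N q. n \<bullet> X = 0) \<and> (\<forall>\<^sub>F t in at_right 0. N (q + t *\<^sub>R n) > 1)"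
    using n(1) tan by (auto simp: eventually_at_right_less eventually_mono[OF eventually_at_right_less])
  fix n' assume n': "norm n' = 1 \<and> (\<forall>X\<in>sphere_tangent N q. n' \<bullet> X = 0) \<and> (\<forall>\<^sub>F t in at_right 0. N (q + t *\<^sub>R n') > 1)"
  then have "n' = n \<or> n' = - n"
    using unit_normal_unique[of n n'] n(1) tan by auto
  moreover have "n' \<noteq> - n"
  proof
    assume eq: "n' = - n"
    have Nq: "N q = 1"
      using q by (simp add: sphere_iff)
    have neg: "N (q + t *\<^sub>R n') \<ge> 1" if t: "t > 0" for t
    proof (rule ccontr)
      assume "\<not> ?thesis"
      then have less: "N (q + t *\<^sub>R n') < 1" by simp
      have "\<forall>\<^sub>F s in at_right 0. s \<in> {0<..<t}"
        using t by (rule eventually_at_right_real)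
      moreover have "\<forall>\<^sub>F s in at_right 0. N (q + s *\<^sub>R n') > 1"
        using n' by blast
      ultimately have "\<forall>\<^sub>F s in at_right (0::real). False"
      proof eventually_elim
        case (elim s)
        have "q + s *\<^sub>R n' = (1 - s / t) *\<^sub>R q + (s / t) *\<^sub>R (q + t *\<^sub>R n')"
          using t by (simp add: algebra_simps)
        then have "N (q + s *\<^sub>R n') \<le> N ((1 - s / t) *\<^sub>R q) + N ((s / t) *\<^sub>R (q + t *\<^sub>R n'))"
          using N_triangle by metis
        also have "\<dots> = (1 - s / t) + (s / t) * N (q + t *\<^sub>R n')"
          using elim(1) t Nq by (simp add: N_scale)
        also have "\<dots> \<le> (1 - s / t) + (s / t) * 1"
          using less elim(1) t by (intro add_left_mono mult_left_mono) auto
        finally show ?case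
          using elim(2) by simp
      qed
      then show False by simp
    qed
    have line: "N (q + t *\<^sub>R n) \<ge> 1" for t
      using out[of t] neg[of "- t"] Nq eq by (cases t "0::real" rule: linorder_cases) auto
    let ?T = "range (\<lambda>t. q + t *\<^sub>R n)"
    have "convex ?T"
    proof -
      have "linear (\<lambda>t. t *\<^sub>R n)" by simp
      then have "convex ((+) q ` range (\<lambda>t. t *\<^sub>R n))"
        by (intro convex_translation convex_linear_image) auto
      then show ?thesis by (simp add: image_image)
    qed
    moreover have "q \<in> ?T"
      by (auto intro: range_eqI[of _ _ 0])
    ultimately obtain m where m: "norm m = 1" "supports m q" "\<And>x. x \<in> ?T \<Longrightarrow> m \<bullet> q \<le> m \<bullet> x"
      using support_separating_convex[of ?T q] line Nq by (smt (verit) rangeE)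
    have "m \<bullet> n = 0"
      using m(3)[OF rangeI[of _ 1]] m(3)[OF rangeI[of _ "-1"]]
      by (simp add: inner_add_right inner_diff_right)
    moreover have "m \<noteq> 0"
      using m(1) by auto
    then have "m \<bullet> X = 0 \<longleftrightarrow> n \<bullet> X = 0" for X
      using sphere_tangent_eq[OF q _ m(2)] tan by blast
    ultimately have "n \<bullet> n = 0" by blast
    then show False using n0 by simp
  qed
  ultimately show "n' = n" by blast
qed

lemma u_inv_supports:
  assumes q: "q \<in> \<S>"
  shows "norm (u_inv N q) = 1" "supports (u_inv N q) q" "0 < u_inv N q \<bullet> q"
proof -
  obtain n where "norm n = 1" "supports n q" "0 < n \<bullet> q"
    using support_separating_convex[of "{q}" q] q by (auto simp: sphere_iff)
  then show "norm (u_inv N q) = 1" "supports (u_inv N q) q" "0 < u_inv N q \<bullet> q"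
    using u_inv_eq[OF q] by auto
qed

lemma u_inv_nonzero: "q \<in> \<S> \<Longrightarrow> u_inv N q \<noteq> 0"
  using u_inv_supports(1) by fastforce

text \<open>In a chart, a normal vector field is the cross product \<open>c\<close> of the two partial derivatives of the
  parametrization \<open>x\<close>. It may point inwards; since outward normals have positive inner product
  with \<open>x\<close>, the field \<open>\<langle>c, x\<rangle> c\<close> is outward whichever sign \<open>c\<close> has.\<close>

lemma u_inv_differentiable:
  assumes c: "(U, \<phi>) \<in> embedded_charts \<S>" and y0: "y0 \<in> \<phi> ` U"
  shows "(\<lambda>y. u_inv N (inv_into U \<phi> y)) differentiable (at y0)"
proof -
  define x where "x = inv_into U \<phi>"
  define c where "c y = cross3 (frechet_derivative x (at y) (axis 1 1)) (frechet_derivative x (at y) (axis 2 1))" for y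
  define w where "w y = (c y \<bullet> x y) *\<^sub>R c y" for y
  note C = embedded_chartD[OF assms(1), folded x_def]
  have w: "w y \<noteq> 0 \<and> u_inv N (x y) = w y /\<^sub>R norm (w y)" if y: "y \<in> \<phi> ` U" for y
  proof -
    let ?n = "u_inv N (x y)"
    note q = C(8)[OF y]
    have c0: "c y \<noteq> 0"
      unfolding c_def by (rule cross3_nonzero[OF C(6,7)[OF y]])
    have "c y \<bullet> frechet_derivative x (at y) v = 0" for v
    proof -
      have "v = (v $ 1) *\<^sub>R axis 1 1 + (v $ 2) *\<^sub>R axis 2 1"
        by (simp add: vec_eq_iff forall_2 axis_def)
      then have "frechet_derivative x (at y) v =
          frechet_derivative x (at y) ((v $ 1) *\<^sub>R axis 1 1 + (v $ 2) *\<^sub>R axis 2 1)"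
        by (rule arg_cong)
      also have "\<dots> = (v $ 1) *\<^sub>R frechet_derivative x (at y) (axis 1 1)
          + (v $ 2) *\<^sub>R frechet_derivative x (at y) (axis 2 1)"
        by (simp only: linear_add[OF C(6)[OF y]] linear_cmul[OF C(6)[OF y]])
      finally show ?thesis
        by (simp add: c_def inner_add_right dot_cross_self)
    qed
    moreover have "X \<in> range (frechet_derivative x (at y))" if "?n \<bullet> X = 0" for X
      using embedded_chart_range[OF assms(1) y u_inv_nonzero u_inv_supports(2), folded x_def, OF q q] that by simp
    ultimately have perp: "c y \<bullet> X = 0" if "?n \<bullet> X = 0" for X
      using that by blast
    have "c y /\<^sub>R norm (c y) = ?n \<or> c y /\<^sub>R norm (c y) = - ?n"
      using c0 perp by (intro unit_normal_unique u_inv_supports(1) q) auto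
    then obtain j where j: "c y /\<^sub>R norm (c y) = j *\<^sub>R ?n"
      by (metis scaleR_minus1_left scaleR_one)
    have "c y = norm (c y) *\<^sub>R (c y /\<^sub>R norm (c y))"
      using c0 by simp
    also have "\<dots> = (norm (c y) * j) *\<^sub>R ?n"
      by (simp only: j scaleR_scaleR)
    finally obtain k where k: "c y = k *\<^sub>R ?n"
      by blast
    have k0: "k \<noteq> 0" using k c0 by auto
    define r where "r = k\<^sup>2 * (?n \<bullet> x y)"
    have "0 < r"
      using u_inv_supports(3)[OF q] k0 by (simp add: r_def)
    moreover have "w y = r *\<^sub>R ?n"
      by (simp add: w_def k r_def power2_eq_square)
    ultimately show ?thesis
      using u_inv_supports(1)[OF q] u_inv_nonzero[OF q] by simp
  qed
  have "bounded_bilinear cross3"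
    using bilinear_cross bilinear_conv_bounded_bilinear by blast
  then have "c differentiable (at y0)"
    unfolding c_def differentiable_def
    using bounded_bilinear.FDERIV smooth_on_has_derivative[OF smooth_on_derivative[OF C(5)] y0] by blast
  moreover have "x differentiable (at y0)"
    by (rule smooth_on_differentiable[OF C(5) y0])
  ultimately have dw: "w differentiable (at y0)"
    unfolding w_def by (intro differentiable_scaleR differentiable_inner)
  have "norm differentiable (at (w y0))"
    using w[OF y0] by (intro differentiable_norm_at) simp
  then have "(norm \<circ> w) differentiable (at y0)"
    using dw by (rule differentiable_chain_at[rotated])
  then have "(\<lambda>y. w y /\<^sub>R norm (w y)) differentiable (at y0)"
    using dw w[OF y0] by (intro differentiable_scaleR differentiable_inverse) (auto simp: comp_def)
  then show ?thesis
    unfolding x_def[symmetric] differentiable_def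
    using has_derivative_transform_within_open[OF _ C(2) y0] w by (metis (no_types, lifting))
qed

lemma sphere_tangent_u_inv:
  assumes "q \<in> \<S>"
  shows "sphere_tangent N q = {X. u_inv N q \<bullet> X = 0}"
  by (rule sphere_tangent_eq[OF assms u_inv_nonzero u_inv_supports(2)]) fact+

lemma d_u_inv_in_chart:
  assumes q: "q \<in> \<S>"
  obtains U \<phi> \<nu>' where "(U, \<phi>) \<in> embedded_charts \<S>" "q \<in> U" "\<phi> q \<in> \<phi> ` U" "inv_into U \<phi> (\<phi> q) = q"
    "((\<lambda>y. u_inv N (inv_into U \<phi> y)) has_derivative \<nu>') (at (\<phi> q))"
    "\<forall>a. d_u_inv N q (frechet_derivative (inv_into U \<phi>) (at (\<phi> q)) a) = \<nu>' a"
proof -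
  obtain U \<phi> where c: "chart_at (embedded_charts \<S>) q = (U, \<phi>)" "(U, \<phi>) \<in> embedded_charts \<S>"
    "q \<in> U" "\<phi> q \<in> \<phi> ` U" "inv_into U \<phi> (\<phi> q) = q"
    by (rule chart_at_sphere[OF q])
  have id: "(\<lambda>x. x) \<circ> inv_into U \<phi> = inv_into U \<phi>"
    by auto
  have "d_u_inv N q (frechet_derivative (inv_into U \<phi>) (at (\<phi> q)) a)
      = frechet_derivative (u_inv N \<circ> inv_into U \<phi>) (at (\<phi> q)) a" for a
    using embedded_chartD(7)[OF c(2,4)]
    by (simp add: d_u_inv_def tangent_map_def differential_def in_chart_def c(1) id)
  moreover have "((\<lambda>y. u_inv N (inv_into U \<phi> y)) has_derivative
      frechet_derivative (u_inv N \<circ> inv_into U \<phi>) (at (\<phi> q))) (at (\<phi> q))"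
    using frechet_derivative_works[THEN iffD1, OF u_inv_differentiable[OF c(2,4)]] by (simp add: comp_def)
  ultimately show ?thesis
    using that c by blast
qed

lemma d_u_inv_tangent:
  assumes q: "q \<in> \<S>" and X: "u_inv N q \<bullet> X = 0"
  shows "u_inv N q \<bullet> d_u_inv N q X = 0"
    and "u_inv N q \<bullet> Y = 0 \<Longrightarrow> d_u_inv N q (s *\<^sub>R X + t *\<^sub>R Y) = s *\<^sub>R d_u_inv N q X + t *\<^sub>R d_u_inv N q Y"
    and "u_inv N q \<bullet> Y = 0 \<Longrightarrow> d_u_inv N q X \<bullet> Y = d_u_inv N q Y \<bullet> X"
proof -
  obtain U \<phi> \<nu>' where c: "(U, \<phi>) \<in> embedded_charts \<S>" "q \<in> U" "\<phi> q \<in> \<phi> ` U" "inv_into U \<phi> (\<phi> q) = q"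
    and \<nu>: "((\<lambda>y. u_inv N (inv_into U \<phi> y)) has_derivative \<nu>') (at (\<phi> q))"
    and D: "\<forall>a. d_u_inv N q (frechet_derivative (inv_into U \<phi>) (at (\<phi> q)) a) = \<nu>' a"
    by (rule d_u_inv_in_chart[OF q])
  define T where "T = frechet_derivative (inv_into U \<phi>) (at (\<phi> q))"
  note C = embedded_chartD[OF c(1)]
  have T: "linear T"
    unfolding T_def by (rule C(6)[OF c(3)])
  have normal: "u_inv N (inv_into U \<phi> y) \<bullet> frechet_derivative (inv_into U \<phi>) (at y) v = 0" if y: "y \<in> \<phi> ` U" for y v
    using embedded_chart_range[OF c(1) y u_inv_nonzero u_inv_supports(2)] C(8)[OF y] by blast
  have range: "range T = {X. u_inv N q \<bullet> X = 0}"
    unfolding T_def using embedded_chart_range[OF c(1,3) u_inv_nonzero[OF q]] u_inv_supports(2)[OF q] c(4) by simp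
  then obtain a where a: "X = T a"
    using X by blast
  have "u_inv N (inv_into U \<phi> (\<phi> q)) \<bullet> \<nu>' a = 0"
    by (rule unit_field_derivative[OF C(2) c(3) \<nu>]) (intro u_inv_supports(1) C(8))
  then show "u_inv N q \<bullet> d_u_inv N q X = 0"
    using D a c(4) by (simp add: T_def)
  assume "u_inv N q \<bullet> Y = 0"
  then obtain b where b: "Y = T b"
    using range by blast
  have "s *\<^sub>R X + t *\<^sub>R Y = T (s *\<^sub>R a + t *\<^sub>R b)"
    unfolding a b by (simp add: linear_add[OF T] linear_cmul[OF T])
  moreover have "linear \<nu>'"
    using \<nu> by (rule has_derivative_linear)
  ultimately show "d_u_inv N q (s *\<^sub>R X + t *\<^sub>R Y) = s *\<^sub>R d_u_inv N q X + t *\<^sub>R d_u_inv N q Y"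
    using D[folded T_def] a b by (simp add: linear_add linear_cmul)
  show "d_u_inv N q X \<bullet> Y = d_u_inv N q Y \<bullet> X"
    unfolding a b D[folded T_def, rule_format] unfolding T_def
    by (rule normal_derivative_symmetric[OF C(2) c(3) C(5) \<nu> normal])
qed

lemma det_d_u_inv_pos:
  assumes "q \<in> \<S>"
  shows "0 < det_on {X. u_inv N q \<bullet> X = 0} (d_u_inv N q)"
  using admissible assms sphere_tangent_u_inv by (simp add: admissible_def)

text \<open>The differential of \<open>u\<^sup>-\<^sup>1\<close> is defined through a chart of the sphere, so \<open>g\<close> has to be factored
  as the parametrization \<open>x\<close> after a map \<open>h\<close> into the parameter domain.\<close>

lemma d_u_inv_chain_rule:
  fixes g :: "'a::real_normed_vector \<Rightarrow> real^3"
  assumes V: "open V" "y0 \<in> V" and g: "(g has_derivative g') (at y0)" "\<And>y. y \<in> V \<Longrightarrow> g y \<in> \<S>"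
    and n: "((\<lambda>y. u_inv N (g y)) has_derivative n') (at y0)"
  shows "d_u_inv N (g y0) (g' v) = n' v"
proof -
  obtain U \<phi> \<nu>' where c: "(U, \<phi>) \<in> embedded_charts \<S>" "g y0 \<in> U" "\<phi> (g y0) \<in> \<phi> ` U" "inv_into U \<phi> (\<phi> (g y0)) = g y0"
    and \<nu>: "((\<lambda>y. u_inv N (inv_into U \<phi> y)) has_derivative \<nu>') (at (\<phi> (g y0)))"
    and D: "\<forall>a. d_u_inv N (g y0) (frechet_derivative (inv_into U \<phi>) (at (\<phi> (g y0))) a) = \<nu>' a"
    by (rule d_u_inv_in_chart[OF g(2)[OF V(2)]])
  define x where "x = inv_into U \<phi>"
  define h where "h y = \<phi> (g y)" for y
  note C = embedded_chartD[OF c(1), folded x_def]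
  obtain W where W: "open W" "U = \<S> \<inter> W"
    using C(1) by (auto simp: openin_open)
  have cont: "isCont g y0"
    using has_derivative_continuous[OF g(1)] .
  have "\<forall>\<^sub>F y in nhds y0. g y \<in> W"
    using cont W c(2) unfolding isCont_def tendsto_at_iff_tendsto_nhds
    by (auto dest: topological_tendstoD)
  moreover have "\<forall>\<^sub>F y in nhds y0. y \<in> V"
    using V by (rule eventually_nhds_in_open)
  ultimately have evU: "\<forall>\<^sub>F y in nhds y0. g y \<in> U"
    by eventually_elim (use W(2) g(2) in blast)
  have xh: "x (h y) = g y" if "g y \<in> U" for y
    using that C(4) by (simp add: x_def h_def)
  have "isCont h y0"
  proof -
    have "((\<lambda>y. \<phi> (g y)) \<longlongrightarrow> \<phi> (g y0)) (at y0)"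
    proof (rule continuous_on_tendsto_compose[OF C(3)])
      show "(g \<longlongrightarrow> g y0) (at y0)"
        using cont by (simp add: isCont_def)
      show "\<forall>\<^sub>F y in at y0. g y \<in> U"
        using evU by (simp add: eventually_nhds_conv_at)
    qed (fact c(2))
    then show ?thesis
      unfolding isCont_def h_def .
  qed
  moreover have y: "h y0 \<in> \<phi> ` U"
    using c(3) by (simp add: h_def)
  moreover have "\<forall>\<^sub>F y in nhds y0. x (h y) = g y"
    using evU by eventually_elim (rule xh)
  ultimately obtain h' where h: "(h has_derivative h') (at y0)"
    using has_derivative_factor_immersion[OF smooth_on_has_derivative[OF C(5)] C(7) g(1)] by blast
  have comp: "((\<lambda>y. x (h y)) has_derivative (\<lambda>v. frechet_derivative x (at (h y0)) (h' v))) (at y0)"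
    by (rule has_derivative_compose[OF h smooth_on_has_derivative[OF C(5) y]])
  obtain V' where V': "open V'" "y0 \<in> V'" "\<And>y. y \<in> V' \<Longrightarrow> g y \<in> U"
    using evU by (auto simp: eventually_nhds)
  have "(g has_derivative (\<lambda>v. frechet_derivative x (at (h y0)) (h' v))) (at y0)"
    by (rule has_derivative_transform_within_open[OF comp V'(1,2)]) (simp add: xh V'(3))
  then have g': "g' v = frechet_derivative x (at (h y0)) (h' v)"
    using fun_cong[OF has_derivative_unique[OF g(1)]] by blast
  have "((\<lambda>y. u_inv N (x (h y))) has_derivative (\<lambda>v. \<nu>' (h' v))) (at y0)"
    by (rule has_derivative_compose[OF h]) (use \<nu> in \<open>simp add: x_def h_def\<close>)
  then have "((\<lambda>y. u_inv N (g y)) has_derivative (\<lambda>v. \<nu>' (h' v))) (at y0)"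
    by (rule has_derivative_transform_within_open[OF _ V'(1,2)]) (simp add: xh V'(3))
  then have "n' v = \<nu>' (h' v)"
    using fun_cong[OF has_derivative_unique[OF n]] by blast
  then show ?thesis
    using D g' by (simp add: x_def h_def)
qed

end

section \<open>Surfaces and their Birkhoff--Gauss maps\<close>

lemma smooth_atlas_chart:
  assumes A: "smooth_atlas M A" and c: "(U, \<phi>) \<in> A"
  shows "open (\<phi> ` U)" "U \<subseteq> topspace M" "inj_on \<phi> U"
    and "openin M W \<Longrightarrow> open (\<phi> ` (U \<inter> W))"
proof -
  have U: "openin M U" and op: "open (\<phi> ` U)"
    and hom: "homeomorphic_map (subtopology M U) (top_of_set (\<phi> ` U)) \<phi>"
    using A c by (auto simp: smooth_atlas_def is_chart_def)
  show "open (\<phi> ` U)" by fact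
  show UM: "U \<subseteq> topspace M"
    using U by (rule openin_subset)
  show "inj_on \<phi> U"
    using homeomorphic_imp_injective_map[OF hom] UM by (simp add: Int_absorb1)
  assume "openin M W"
  then have "openin (subtopology M U) (U \<inter> W)"
    by (simp add: openin_subtopology_Int2)
  then have "openin (top_of_set (\<phi> ` U)) (\<phi> ` (U \<inter> W))"
    using homeomorphic_imp_open_map[OF hom] by (auto simp: open_map_def)
  then show "open (\<phi> ` (U \<inter> W))"
    using op openin_open_trans by blast
qed

lemma chart_at_surface:
  assumes A: "smooth_atlas M A" and p: "p \<in> topspace M"
  obtains U \<phi> where "chart_at A p = (U, \<phi>)" "(U, \<phi>) \<in> A" "p \<in> U"
proof -
  obtain U \<phi> where c: "chart_at A p = (U, \<phi>)"
    by force
  have "\<exists>c. c \<in> A \<and> p \<in> fst c"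
    using A p unfolding smooth_atlas_def by blast
  from someI_ex[OF this] have "(U, \<phi>) \<in> A" "p \<in> U"
    using c by (auto simp: chart_at_def)
  then show ?thesis
    using that c by blast
qed

text \<open>The tangent plane at each point is defined by a chart selected at that point, while derivatives
  along a neighbourhood are taken in one chart; the smooth transition maps connect the two.\<close>

lemma chart_derivative_in_tangent_plane:
  assumes A: "smooth_atlas M A" and f: "smooth_map A f" and c: "(U, \<phi>) \<in> A" and y: "y \<in> \<phi> ` U"
  shows "frechet_derivative (f \<circ> inv_into U \<phi>) (at y) v \<in> tangent_plane A f (inv_into U \<phi> y)"
proof -
  define p where "p = inv_into U \<phi> y"
  have p: "p \<in> U" "\<phi> p = y"
    using y by (auto simp: p_def inv_into_into f_inv_into_f)
  obtain U' \<phi>' where c': "chart_at A p = (U', \<phi>')" "(U', \<phi>') \<in> A" "p \<in> U'"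
    using chart_at_surface[OF A, of p] smooth_atlas_chart(2)[OF A c] p by blast
  define W where "W = \<phi> ` (U \<inter> U')"
  have U': "openin M U'"
    using A c'(2) by (auto simp: smooth_atlas_def is_chart_def)
  have W: "open W" "y \<in> W"
    using smooth_atlas_chart(4)[OF A c U'] p c'(3) by (auto simp: W_def)
  let ?g = "f \<circ> inv_into U' \<phi>'" and ?\<tau> = "\<phi>' \<circ> inv_into U \<phi>"
  have inj: "inj_on \<phi> U" "inj_on \<phi>' U'"
    using smooth_atlas_chart(3)[OF A] c c'(2) by auto
  have "smooth_on W (transition (U, \<phi>) (U', \<phi>'))"
    using A c c'(2) by (force simp: smooth_atlas_def W_def)
  then have "?\<tau> differentiable (at y)"
    using smooth_on_differentiable W(2) by (auto simp: transition_def)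
  moreover have "?\<tau> y = \<phi>' p"
    by (simp add: p_def)
  moreover have "smooth_on (\<phi>' ` U') ?g"
    using f c'(2) by (force simp: smooth_map_def in_chart_def)
  then have "?g differentiable (at (\<phi>' p))"
    using c'(3) by (rule smooth_on_differentiable[OF _ imageI])
  ultimately have comp: "((\<lambda>z. ?g (?\<tau> z)) has_derivative
      (\<lambda>v. frechet_derivative ?g (at (\<phi>' p)) (frechet_derivative ?\<tau> (at y) v))) (at y)"
    by (metis frechet_derivative_works has_derivative_compose)
  have "?g (?\<tau> z) = (f \<circ> inv_into U \<phi>) z" if "z \<in> W" for z
    using that inj by (auto simp: W_def)
  then have "((f \<circ> inv_into U \<phi>) has_derivative
      (\<lambda>v. frechet_derivative ?g (at (\<phi>' p)) (frechet_derivative ?\<tau> (at y) v))) (at y)"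
    using has_derivative_transform_within_open[OF comp W] by blast
  then have "frechet_derivative (f \<circ> inv_into U \<phi>) (at y) v
      = frechet_derivative ?g (at (\<phi>' p)) (frechet_derivative ?\<tau> (at y) v)"
    using frechet_derivative_at by metis
  then show ?thesis
    unfolding p_def[symmetric] by (simp add: tangent_plane_def differential_def c'(1) in_chart_def)
qed

lemma conformal_iff_pointwise:
  "conformal M A f \<eta> m \<longleftrightarrow> (\<forall>p\<in>topspace M. \<exists>r>0. \<forall>X\<in>tangent_plane A f p. \<forall>Y\<in>tangent_plane A f p.
     m p (tangent_map A f \<eta> p X) (tangent_map A f \<eta> p Y) = r * m p X Y)"
proof
  assume "\<forall>p\<in>topspace M. \<exists>r>0. \<forall>X\<in>tangent_plane A f p. \<forall>Y\<in>tangent_plane A f p.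
     m p (tangent_map A f \<eta> p X) (tangent_map A f \<eta> p Y) = r * m p X Y"
  then show "conformal M A f \<eta> m"
    unfolding conformal_def by (auto dest!: bchoice)
qed (unfold conformal_def, blast)

locale birkhoff_surface = admissible_norm N
  for N :: "real^3 \<Rightarrow> real" +
  fixes M :: "'m topology" and A :: "'m chart set" and f \<eta> \<xi> :: "'m \<Rightarrow> real^3"
  assumes surface: "smooth_surface M A" and immersion: "immersion M A f"
    and birkhoff: "birkhoff_gauss_map N M A f \<eta>" and gauss: "euclidean_gauss_map M A f \<xi>"
    and orientation: "\<And>p. p \<in> topspace M \<Longrightarrow> \<xi> p = u_inv N (\<eta> p)"
begin

lemma atlas: "smooth_atlas M A"
  using surface by (simp add: smooth_surface_def)

lemma \<eta>_sphere: "p \<in> topspace M \<Longrightarrow> \<eta> p \<in> \<S>"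
  using birkhoff by (simp add: birkhoff_gauss_map_def)

lemma tangent_plane_normal:
  assumes "p \<in> topspace M" "X \<in> tangent_plane A f p"
  shows "\<xi> p \<bullet> X = 0"
  using gauss assms by (simp add: euclidean_gauss_map_def)

lemma differential_linear:
  assumes g: "smooth_map A g" and p: "p \<in> topspace M"
  shows "linear (differential A g p)"
proof -
  obtain U \<phi> where c: "chart_at A p = (U, \<phi>)" "(U, \<phi>) \<in> A" "p \<in> U"
    by (rule chart_at_surface[OF atlas p])
  have "smooth_on (\<phi> ` U) (in_chart g (U, \<phi>))"
    using g c(2) by (force simp: smooth_map_def)
  then show ?thesis
    unfolding differential_def c(1)
    using c(3) by (auto intro!: linear_frechet_derivative smooth_on_differentiable)
qed

lemma tangent_plane_eq:
  assumes p: "p \<in> topspace M"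
  shows "tangent_plane A f p = {X. \<xi> p \<bullet> X = 0}"
  unfolding tangent_plane_def
proof (rule range_eq_hyperplane)
  show "linear (differential A f p)" "inj (differential A f p)"
    using differential_linear p immersion by (auto simp: immersion_def)
  show "\<xi> p \<noteq> 0"
    using u_inv_nonzero \<eta>_sphere orientation p by simp
  show "\<xi> p \<bullet> differential A f p v = 0" for v
    using tangent_plane_normal[OF p] by (simp add: tangent_plane_def)
qed

lemma tangent_plane_properties:
  assumes p: "p \<in> topspace M"
  shows "subspace (tangent_plane A f p)" "dim (tangent_plane A f p) = 2"
  using dim_hyperplane[of "\<xi> p"] u_inv_nonzero[OF \<eta>_sphere[OF p]] orientation[OF p]
  by (auto simp: tangent_plane_eq[OF p] subspace_hyperplane)

lemma tangent_map_differential: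
  assumes "p \<in> topspace M"
  shows "tangent_map A f g p (differential A f p v) = differential A g p v"
  using immersion assms by (simp add: immersion_def tangent_map_def)

lemma tangent_map_linear:
  assumes g: "smooth_map A g" and p: "p \<in> topspace M"
    and X: "X \<in> tangent_plane A f p" and Y: "Y \<in> tangent_plane A f p"
  shows "tangent_map A f g p (s *\<^sub>R X + t *\<^sub>R Y) = s *\<^sub>R tangent_map A f g p X + t *\<^sub>R tangent_map A f g p Y"
proof -
  have f: "linear (differential A f p)" and g: "linear (differential A g p)"
    using differential_linear p g immersion by (auto simp: immersion_def)
  obtain a b where ab: "X = differential A f p a" "Y = differential A f p b"
    using X Y by (auto simp: tangent_plane_def)
  have "s *\<^sub>R X + t *\<^sub>R Y = differential A f p (s *\<^sub>R a + t *\<^sub>R b)"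
    unfolding ab by (simp add: linear_add[OF f] linear_cmul[OF f])
  then show ?thesis
    using ab by (simp add: tangent_map_differential[OF p] linear_add[OF g] linear_cmul[OF g])
qed

text \<open>Everything needed about the surface near \<open>p\<close>, read in the chart selected at \<open>p\<close>: \<open>F\<close>, \<open>H\<close> and
  \<open>u_inv N \<circ> H\<close> are the local expressions of \<open>f\<close>, \<open>\<eta>\<close> and \<open>\<xi>\<close>.\<close>

lemma birkhoff_gauss_map_in_chart:
  assumes p: "p \<in> topspace M"
  obtains V y0 and F H :: "real^2 \<Rightarrow> real^3" and n' where
    "open V" "y0 \<in> V" "smooth_on V F" "smooth_on V H" "H y0 = \<eta> p"
    "\<forall>y\<in>V. H y \<in> \<S>"
    "((\<lambda>y. u_inv N (H y)) has_derivative n') (at y0)"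
    "\<forall>y\<in>V. \<forall>v. u_inv N (H y) \<bullet> frechet_derivative F (at y) v = 0"
    "\<forall>y\<in>V. \<xi> p \<bullet> H y \<le> \<xi> p \<bullet> \<eta> p"
    "differential A f p = frechet_derivative F (at y0)"
    "differential A \<eta> p = frechet_derivative H (at y0)"
proof -
  obtain U \<phi> where c: "chart_at A p = (U, \<phi>)" "(U, \<phi>) \<in> A" "p \<in> U"
    by (rule chart_at_surface[OF atlas p])
  note C = smooth_atlas_chart[OF atlas c(2)]
  let ?g = "inv_into U \<phi>"
  have smooth: "smooth_on (\<phi> ` U) (g \<circ> ?g)" if "smooth_map A g" for g :: "'m \<Rightarrow> real^3"
    using that c(2) by (force simp: smooth_map_def in_chart_def)
  have f: "smooth_map A f" and \<eta>: "smooth_map A \<eta>" and \<xi>: "smooth_map A \<xi>"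
    using immersion birkhoff gauss
    by (auto simp: immersion_def birkhoff_gauss_map_def euclidean_gauss_map_def)
  have top: "?g y \<in> topspace M" if "y \<in> \<phi> ` U" for y
    using that C(2) by (meson inv_into_into subsetD)
  have y0: "\<phi> p \<in> \<phi> ` U" "?g (\<phi> p) = p"
    using c(3) C(3) by auto
  show ?thesis
  proof (rule that; (intro ballI allI)?)
    show "open (\<phi> ` U)" "\<phi> p \<in> \<phi> ` U"
      using C y0 by auto
    show "smooth_on (\<phi> ` U) (f \<circ> ?g)" "smooth_on (\<phi> ` U) (\<eta> \<circ> ?g)"
      using smooth f \<eta> by auto
    show "(\<eta> \<circ> ?g) (\<phi> p) = \<eta> p"
      using y0 by simp
    show sph: "(\<eta> \<circ> ?g) y \<in> \<S>" if "y \<in> \<phi> ` U" for y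
      using \<eta>_sphere top that by simp
    have "((\<xi> \<circ> ?g) has_derivative frechet_derivative (\<xi> \<circ> ?g) (at (\<phi> p))) (at (\<phi> p))"
      by (rule smooth_on_has_derivative[OF smooth[OF \<xi>] y0(1)])
    then show "((\<lambda>y. u_inv N ((\<eta> \<circ> ?g) y)) has_derivative frechet_derivative (\<xi> \<circ> ?g) (at (\<phi> p))) (at (\<phi> p))"
      by (rule has_derivative_transform_within_open[OF _ C(1) y0(1)]) (simp add: orientation top)
    show "u_inv N ((\<eta> \<circ> ?g) y) \<bullet> frechet_derivative (f \<circ> ?g) (at y) v = 0" if "y \<in> \<phi> ` U" for y v
      using tangent_plane_normal[OF top[OF that] chart_derivative_in_tangent_plane[OF atlas f c(2) that]]
        orientation[OF top[OF that]] by simp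
    show "\<xi> p \<bullet> (\<eta> \<circ> ?g) y \<le> \<xi> p \<bullet> \<eta> p" if y: "y \<in> \<phi> ` U" for y
    proof -
      have "birkhoff_orthogonal N (\<eta> p) (tangent_plane A f p)"
        using birkhoff p by (simp add: birkhoff_gauss_map_def)
      then have "\<bar>\<xi> p \<bullet> (\<eta> \<circ> ?g) y\<bar> \<le> \<bar>\<xi> p \<bullet> \<eta> p\<bar>"
        using birkhoff_orthogonal_supports[of "tangent_plane A f p" "\<xi> p" "\<eta> p" "(\<eta> \<circ> ?g) y"]
          sph[OF y] \<eta>_sphere[OF p] by (simp add: tangent_plane_eq[OF p] sphere_iff)
      then show ?thesis
        using u_inv_supports(3)[OF \<eta>_sphere[OF p]] orientation[OF p] by simp
    qed
    show "differential A f p = frechet_derivative (f \<circ> ?g) (at (\<phi> p))"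
      "differential A \<eta> p = frechet_derivative (\<eta> \<circ> ?g) (at (\<phi> p))"
      by (simp_all add: differential_def c(1) in_chart_def)
  qed
qed

text \<open>The plane \<open>\<eta> p + T\<^sub>pM\<close> supports the ball, so \<open>\<langle>\<xi> p, \<eta>\<rangle>\<close> is maximal at \<open>p\<close>.\<close>

lemma tangent_map_\<eta>_tangent:
  assumes p: "p \<in> topspace M" and X: "X \<in> tangent_plane A f p"
  shows "tangent_map A f \<eta> p X \<in> tangent_plane A f p"
proof -
  obtain V y0 and F H :: "real^2 \<Rightarrow> real^3" and n' where V: "open V" "y0 \<in> V"
    and "smooth_on V F" and H: "smooth_on V H" "H y0 = \<eta> p" and "\<forall>y\<in>V. H y \<in> \<S>"
    and "((\<lambda>y. u_inv N (H y)) has_derivative n') (at y0)"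
    and "\<forall>y\<in>V. \<forall>v. u_inv N (H y) \<bullet> frechet_derivative F (at y) v = 0"
    and supp: "\<forall>y\<in>V. \<xi> p \<bullet> H y \<le> \<xi> p \<bullet> \<eta> p"
    and "differential A f p = frechet_derivative F (at y0)"
    and dH: "differential A \<eta> p = frechet_derivative H (at y0)"
    by (rule birkhoff_gauss_map_in_chart[OF p])
  have "((\<lambda>y. \<xi> p \<bullet> H y) has_derivative (\<lambda>v. \<xi> p \<bullet> frechet_derivative H (at y0) v)) (at y0)"
    by (intro has_derivative_inner_right smooth_on_has_derivative[OF H(1) V(2)])
  then have "(\<lambda>v. \<xi> p \<bullet> frechet_derivative H (at y0) v) = (\<lambda>v. 0)"
    using supp H(2) by (intro differential_zero_maxmin[OF V(2,1)]) auto
  then have "\<xi> p \<bullet> differential A \<eta> p v = 0" for v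
    unfolding dH by metis
  moreover obtain v where "X = differential A f p v"
    using X by (auto simp: tangent_plane_def)
  ultimately have "\<xi> p \<bullet> tangent_map A f \<eta> p X = 0"
    by (simp add: tangent_map_differential[OF p])
  then show ?thesis
    by (simp add: tangent_plane_eq[OF p])
qed

text \<open>By the chain rule \<open>du\<^sup>-\<^sup>1 \<circ> d\<eta> = d\<xi>\<close>, and \<open>\<langle>d\<xi> X, Y\<rangle>\<close> is, up to sign, the Euclidean second
  fundamental form of \<open>M\<close>.\<close>

lemma d_u_inv_tangent_map_symmetric:
  assumes p: "p \<in> topspace M" and X: "X \<in> tangent_plane A f p" and Y: "Y \<in> tangent_plane A f p"
  shows "d_u_inv N (\<eta> p) (tangent_map A f \<eta> p X) \<bullet> Y = d_u_inv N (\<eta> p) (tangent_map A f \<eta> p Y) \<bullet> X"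
proof -
  obtain V y0 and F H :: "real^2 \<Rightarrow> real^3" and n' where V: "open V" "y0 \<in> V"
    and F: "smooth_on V F" and H: "smooth_on V H" "H y0 = \<eta> p" and sph: "\<forall>y\<in>V. H y \<in> \<S>"
    and n: "((\<lambda>y. u_inv N (H y)) has_derivative n') (at y0)"
    and normal: "\<forall>y\<in>V. \<forall>v. u_inv N (H y) \<bullet> frechet_derivative F (at y) v = 0"
    and "\<forall>y\<in>V. \<xi> p \<bullet> H y \<le> \<xi> p \<bullet> \<eta> p"
    and dF: "differential A f p = frechet_derivative F (at y0)"
    and dH: "differential A \<eta> p = frechet_derivative H (at y0)"
    by (rule birkhoff_gauss_map_in_chart[OF p])
  obtain a b where ab: "X = differential A f p a" "Y = differential A f p b"
    using X Y by (auto simp: tangent_plane_def)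
  have D: "d_u_inv N (\<eta> p) (differential A \<eta> p v) = n' v" for v
    using d_u_inv_chain_rule[OF V smooth_on_has_derivative[OF H(1) V(2)] _ n, of v] sph
    unfolding dH H(2) by blast
  show ?thesis
    unfolding ab tangent_map_differential[OF p] D unfolding dF
    by (rule normal_derivative_symmetric[OF V F n]) (use normal in blast)
qed

lemma trace_tangent_map_zero_iff:
  assumes p: "p \<in> topspace M" and K: "minkowski_gauss_curvature A f \<eta> p < 0"
  shows "trace_on (tangent_plane A f p) (tangent_map A f \<eta> p) = 0 \<longleftrightarrow>
    (\<exists>r>0. \<forall>X\<in>tangent_plane A f p. \<forall>Y\<in>tangent_plane A f p.
      d_u_inv N (\<eta> p) (tangent_map A f \<eta> p X) \<bullet> tangent_map A f \<eta> p Y = r * (d_u_inv N (\<eta> p) X \<bullet> Y))"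
proof (rule trace_zero_iff_conformal)
  have plane: "X \<in> tangent_plane A f p \<longleftrightarrow> u_inv N (\<eta> p) \<bullet> X = 0" for X
    using tangent_plane_eq[OF p] orientation[OF p] by simp
  note D = d_u_inv_tangent[OF \<eta>_sphere[OF p]]
  show "d_u_inv N (\<eta> p) X \<in> tangent_plane A f p" if "X \<in> tangent_plane A f p" for X
    using D(1) that unfolding plane .
  fix X Y assume XY: "X \<in> tangent_plane A f p" "Y \<in> tangent_plane A f p"
  show "d_u_inv N (\<eta> p) (s *\<^sub>R X + t *\<^sub>R Y) = s *\<^sub>R d_u_inv N (\<eta> p) X + t *\<^sub>R d_u_inv N (\<eta> p) Y" for s t
    using D(2) XY unfolding plane .
  show "d_u_inv N (\<eta> p) X \<bullet> Y = d_u_inv N (\<eta> p) Y \<bullet> X"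
    using D(3) XY unfolding plane .
  show "d_u_inv N (\<eta> p) (tangent_map A f \<eta> p X) \<bullet> Y = d_u_inv N (\<eta> p) (tangent_map A f \<eta> p Y) \<bullet> X"
    by (rule d_u_inv_tangent_map_symmetric[OF p XY])
  show "tangent_map A f \<eta> p (s *\<^sub>R X + t *\<^sub>R Y) = s *\<^sub>R tangent_map A f \<eta> p X + t *\<^sub>R tangent_map A f \<eta> p Y" for s t
    using birkhoff by (intro tangent_map_linear[OF _ p XY]) (simp add: birkhoff_gauss_map_def)
next
  show "det_on (tangent_plane A f p) (d_u_inv N (\<eta> p)) \<noteq> 0"
    using det_d_u_inv_pos[OF \<eta>_sphere[OF p]] tangent_plane_eq[OF p] orientation[OF p] by simp
  show "det_on (tangent_plane A f p) (tangent_map A f \<eta> p) < 0"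
    using K by (simp add: minkowski_gauss_curvature_def)
qed (simp_all add: tangent_plane_properties p tangent_map_\<eta>_tangent)

lemma minimal_iff_conformal_dupin:
  assumes K: "\<And>p. p \<in> topspace M \<Longrightarrow> minkowski_gauss_curvature A f \<eta> p < 0"
  shows "minimal M A f \<eta> \<longleftrightarrow> conformal M A f \<eta> (dupin_metric N \<eta>)"
  using trace_tangent_map_zero_iff[OF _ K]
  by (simp add: conformal_iff_pointwise dupin_metric_def minimal_def minkowski_mean_curvature_def)

text \<open>At each point the two metrics differ by the factor \<open>\<langle>\<eta> p, \<xi> p\<rangle>\<close>, which is positive and cancels.\<close>

lemma conformal_weighted_dupin_iff:
  "conformal M A f \<eta> (weighted_dupin_metric N \<eta> \<xi>) \<longleftrightarrow> conformal M A f \<eta> (dupin_metric N \<eta>)"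
proof -
  have "\<eta> p \<bullet> \<xi> p \<noteq> 0" if "p \<in> topspace M" for p
    using u_inv_supports(3)[OF \<eta>_sphere[OF that]] orientation[OF that] by (simp add: inner_commute)
  then show ?thesis
    unfolding conformal_def weighted_dupin_metric_def dupin_metric_def
    by (intro ex_cong1 conj_cong ball_cong refl) (simp add: divide_eq_eq)
qed

end

theorem theorem2p2:
  fixes N :: "real^3 \<Rightarrow> real"
    and M :: "'m topology" and A :: "'m chart set"
    and f \<eta> \<xi> :: "'m \<Rightarrow> real^3"
  assumes "admissible N"
    and "smooth_surface M A"
    and "immersion M A f"
    and "birkhoff_gauss_map N M A f \<eta>"
    and "euclidean_gauss_map M A f \<xi>"
    and "\<And>p. p \<in> topspace M \<Longrightarrow> \<xi> p = u_inv N (\<eta> p)"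
    and "\<And>p. p \<in> topspace M \<Longrightarrow> minkowski_gauss_curvature A f \<eta> p < 0"
  shows "(minimal M A f \<eta> \<longleftrightarrow> conformal M A f \<eta> (weighted_dupin_metric N \<eta> \<xi>)) \<and>
         (minimal M A f \<eta> \<longleftrightarrow> conformal M A f \<eta> (dupin_metric N \<eta>))"
proof -
  interpret birkhoff_surface N M A f \<eta> \<xi>
    using assms by unfold_locales auto
  show ?thesis
    using minimal_iff_conformal_dupin[OF assms(7)] conformal_weighted_dupin_iff by blast
qed

end
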